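(* Let $\mathbf{P} = (G, D, \diamond, I)$ be a partial semigroup with identity and let $\mathbf{S} = (S, \cdot^{\mathbf{S}}, +^{\mathbf{S}}, 1^{\mathbf{S}}, 0^{\mathbf{S}})$ be a complete idempotent semiring. Then the structure $\mathbf{S^{P}} = (S^{G}, B, W, \cdot, +, {}^{*}, {}^{-}, 1, 0)$ (defined below) is a $^{*}$-continuous Kleene algebra with weights and tests, and the semiring $(W, \cdot, +, 1, 0)$ is isomorphic to $\mathbf{S}$.
   Context: A semiring $(S,+,\cdot,1,0)$ has $(S,+,0)$ a commutative monoid, $(S,\cdot,1)$ a monoid, $\cdot$ distributing over $+$ on both sides, and $0$ annihilating. It is idempotent if $x+x=x$; it is complete if $(S,+,0)$ is a complete monoid (sums $\sum_{i\in J} x_i$ of arbitrary families are defined, extending finite sums and satisfying generalized associativity and commutativity) and $x\cdot\sum_i x_i=\sum_i x\cdot x_i$, $(\sum_i x_i)\cdot x=\sum_i x_i\cdot x$ for arbitrary families. In an idempotent semiring, $x\le y$ iff $x+y=y$. A Kleene algebra is an idempotent semiring with a unary operation $^{*}$ satisfying $1+xx^{*}\le x^{*}$, $1+x^{*}x\le x^{*}$, $y+xz\le z \Rightarrow x^{*}y\le z$, and $y+zx\le z\Rightarrow yx^{*}\le z$. It is $^{*}$-continuous if $xy^{*}z=\sum_{n\ge 0} xy^{n}z$ (supremum w.r.t. $\le$) for all $x,y,z$. A Kleene algebra with weights and tests is a structure $(K,B,S,\cdot,+,{}^{*},{}^{-},1,0)$ where $(K,\cdot,+,{}^{*},1,0)$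 is a Kleene algebra, $B\subseteq K$ and $S\subseteq K$, $(B,\cdot,+,{}^{-},1,0)$ is a Boolean algebra (with the operations of $K$ restricted to $B$ and ${}^{-}$ its complement), and $(S,\cdot,+,1,0)$ is a semiring (with the operations of $K$ restricted to $S$). It is $^{*}$-continuous if its Kleene algebra reduct is. A partial semigroup with identity is $(G,D,\diamond,I)$ with $G\neq\emptyset$, $D\subseteq G\times G$, $\diamond: D\to G$ (write $xy$ for $x\diamond y$), $I\subseteq G$, such that: (1) $D(x,y)$ and $D(xy,z)$ iff $D(y,z)$ and $D(x,yz)$; (2) if $D(x,y)$ and $D(xy,z)$ then $(xy)z=x(yz)$; (3) for every $x$ there is $y$ with $I(y)$ and $D(x,y)$; (4) for every $x$ there is $y$ with $I(y)$ and $D(y,x)$; (5) if $D(x,y)$ and $I(y)$ then $x=xy$; (6) if $D(y,x)$ and $I(y)$ then $x=yx$. $\mathbf{S^P}$: $S^G$ is the set of all functions $G\to S$, and for $\lambda,\lambda'\in S^G$, $x\in G$: $1(x)=1^{\mathbf{S}}$ if $x\in I$ and $0^{\mathbf{S}}$ otherwise; $0(x)=0^{\mathbf{S}}$; $(\lambda\cdot\lambda')(x)=\sum\{\lambda(y)\cdot^{\mathbf{S}}\lambda'(z)\mid (y,z)\in D,\ y\diamond z=x\}$ (sum in $\mathbf{S}$); $(\lambda+\lambda')(x)=\lambda(x)+^{\mathbf{S}}\lambda'(x)$; $\lambda^{0}=1$, $\lambda^{n+1}=\lambda^{n}\cdot\lambda$, $\lambda^{*}(x)=\sum_{n\ge 0}\lambda^{n}(x)$;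 $B=\{\lambda\mid \lambda(x)\in\{1^{\mathbf{S}},0^{\mathbf{S}}\}$ for all $x$, and $\lambda(x)=1^{\mathbf{S}}$ only if $x\in I\}$; $W=\{\lambda\mid \lambda(x)=0^{\mathbf{S}}$ for $x\notin I$, and $\lambda(y)=\lambda(z)$ for all $y,z\in I\}$; ${}^{-}:B\to B$ is given by $\bar\lambda(x)=1^{\mathbf{S}}$ iff $x\in I$ and $\lambda(x)\neq 1^{\mathbf{S}}$ (and $\bar\lambda(x)=0^{\mathbf{S}}$ otherwise).
   Formalization: It is assumed in addition that the sum of countably many copies of x equals x in S (the claim fails without it, and implies it); tests in B are required to be 0 off I, which differs from the given B only if 1=0 in S and I≠G, where the given B is empty. *)

theory Defs
  imports "HOL-Algebra.Ring" "HOL-Algebra.QuotRing" "HOL-Algebra.Order"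
    "HOL-Library.Disjoint_Sets" "HOL-Library.Equipollence"
begin

section \<open>Idempotent semirings and Kleene algebras\<close>

locale idem_semiring = semiring R for R (structure) +
  assumes add_idem: "x \<in> carrier R \<Longrightarrow> x \<oplus> x = x"

definition nat_order :: "('a, 'm) ring_scheme \<Rightarrow> 'a gorder" where
  "nat_order R = \<lparr>carrier = carrier R, eq = (=), le = (\<lambda>x y. x \<oplus>\<^bsub>R\<^esub> y = y)\<rparr>"

record 'a star_ring = "'a ring" +
  star :: "'a \<Rightarrow> 'a"

locale kleene_algebra = idem_semiring K for K :: "('a, 'm) star_ring_scheme" (structure) +
  assumes star_closed: "x \<in> carrier K \<Longrightarrow> star K x \<in> carrier K"
    and star_unfold_left: "x \<in> carrier K \<Longrightarrow>
      \<one> \<oplus> x \<otimes> star K x \<sqsubseteq>\<^bsub>nat_order K\<^esub> star K x"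
    and star_unfold_right: "x \<in> carrier K \<Longrightarrow>
      \<one> \<oplus> star K x \<otimes> x \<sqsubseteq>\<^bsub>nat_order K\<^esub> star K x"
    and star_induct_left: "\<lbrakk>x \<in> carrier K; y \<in> carrier K; z \<in> carrier K;
      y \<oplus> x \<otimes> z \<sqsubseteq>\<^bsub>nat_order K\<^esub> z\<rbrakk> \<Longrightarrow> star K x \<otimes> y \<sqsubseteq>\<^bsub>nat_order K\<^esub> z"
    and star_induct_right: "\<lbrakk>x \<in> carrier K; y \<in> carrier K; z \<in> carrier K;
      y \<oplus> z \<otimes> x \<sqsubseteq>\<^bsub>nat_order K\<^esub> z\<rbrakk> \<Longrightarrow> y \<otimes> star K x \<sqsubseteq>\<^bsub>nat_order K\<^esub> z"

definition star_continuous :: "('a, 'm) star_ring_scheme \<Rightarrow> bool" where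
  "star_continuous K \<longleftrightarrow>
    (\<forall>x \<in> carrier K. \<forall>y \<in> carrier K. \<forall>z \<in> carrier K.
      least (nat_order K) (x \<otimes>\<^bsub>K\<^esub> star K y \<otimes>\<^bsub>K\<^esub> z)
        (Upper (nat_order K) {x \<otimes>\<^bsub>K\<^esub> (y [^]\<^bsub>K\<^esub> n) \<otimes>\<^bsub>K\<^esub> z | n :: nat. True}))"


section \<open>Kleene algebras with weights and tests\<close>

locale boolean_algebra_on =
  fixes B :: "'a set" and meet join :: "'a \<Rightarrow> 'a \<Rightarrow> 'a" and neg :: "'a \<Rightarrow> 'a" and top bot :: 'a
  assumes top_closed: "top \<in> B"
    and bot_closed: "bot \<in> B"
    and neg_closed: "x \<in> B \<Longrightarrow> neg x \<in> B"
    and meet_closed: "\<lbrakk>x \<in> B; y \<in> B\<rbrakk> \<Longrightarrow> meet x y \<in> B"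
    and join_closed: "\<lbrakk>x \<in> B; y \<in> B\<rbrakk> \<Longrightarrow> join x y \<in> B"
    and meet_assoc: "\<lbrakk>x \<in> B; y \<in> B; z \<in> B\<rbrakk> \<Longrightarrow> meet (meet x y) z = meet x (meet y z)"
    and join_assoc: "\<lbrakk>x \<in> B; y \<in> B; z \<in> B\<rbrakk> \<Longrightarrow> join (join x y) z = join x (join y z)"
    and meet_comm: "\<lbrakk>x \<in> B; y \<in> B\<rbrakk> \<Longrightarrow> meet x y = meet y x"
    and join_comm: "\<lbrakk>x \<in> B; y \<in> B\<rbrakk> \<Longrightarrow> join x y = join y x"
    and meet_absorb: "\<lbrakk>x \<in> B; y \<in> B\<rbrakk> \<Longrightarrow> meet x (join x y) = x"
    and join_absorb: "\<lbrakk>x \<in> B; y \<in> B\<rbrakk> \<Longrightarrow> join x (meet x y) = x"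
    and meet_distrib: "\<lbrakk>x \<in> B; y \<in> B; z \<in> B\<rbrakk> \<Longrightarrow>
      meet x (join y z) = join (meet x y) (meet x z)"
    and join_distrib: "\<lbrakk>x \<in> B; y \<in> B; z \<in> B\<rbrakk> \<Longrightarrow>
      join x (meet y z) = meet (join x y) (join x z)"
    and meet_top: "x \<in> B \<Longrightarrow> meet x top = x"
    and join_bot: "x \<in> B \<Longrightarrow> join x bot = x"
    and meet_neg: "x \<in> B \<Longrightarrow> meet x (neg x) = bot"
    and join_neg: "x \<in> B \<Longrightarrow> join x (neg x) = top"

record 'a kawt = "'a star_ring" +
  tests :: "'a set"
  weights :: "'a set"
  test_compl :: "'a \<Rightarrow> 'a"

definition weight_semiring :: "('a, 'm) kawt_scheme \<Rightarrow> 'a ring" where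
  "weight_semiring K =
    \<lparr>carrier = weights K, mult = mult K, one = one K, zero = zero K, add = add K\<rparr>"

locale kleene_algebra_weights_tests = kleene_algebra K for K :: "('a, 'm) kawt_scheme" (structure) +
  assumes tests_subset: "tests K \<subseteq> carrier K"
    and weights_subset: "weights K \<subseteq> carrier K"
    and tests_boolean: "boolean_algebra_on (tests K) (mult K) (add K) (test_compl K) \<one> \<zero>"
    and weights_semiring: "semiring (weight_semiring K)"


section \<open>Partial semigroups with identity\<close>

record 'g psemigroup = "'g partial_object" +
  defd :: "('g \<times> 'g) set"
  pmult :: "'g \<Rightarrow> 'g \<Rightarrow> 'g" (infixl \<open>\<diamondop>\<index>\<close> 70)
  ids :: "'g set"

locale partial_semigroup = fixes P :: "('g, 'p) psemigroup_scheme" (structure)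
  assumes nonempty: "carrier P \<noteq> {}"
    and defd_subset: "defd P \<subseteq> carrier P \<times> carrier P"
    and pmult_closed: "(x, y) \<in> defd P \<Longrightarrow> x \<diamondop> y \<in> carrier P"
    and ids_subset: "ids P \<subseteq> carrier P"
    and defd_assoc: "\<lbrakk>x \<in> carrier P; y \<in> carrier P; z \<in> carrier P\<rbrakk> \<Longrightarrow>
      (x, y) \<in> defd P \<and> (x \<diamondop> y, z) \<in> defd P \<longleftrightarrow> (y, z) \<in> defd P \<and> (x, y \<diamondop> z) \<in> defd P"
    and pmult_assoc: "\<lbrakk>(x, y) \<in> defd P; (x \<diamondop> y, z) \<in> defd P\<rbrakk> \<Longrightarrow>
      (x \<diamondop> y) \<diamondop> z = x \<diamondop> (y \<diamondop> z)"
    and right_id_ex: "x \<in> carrier P \<Longrightarrow> \<exists>y \<in> ids P. (x, y) \<in> defd P"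
    and left_id_ex: "x \<in> carrier P \<Longrightarrow> \<exists>y \<in> ids P. (y, x) \<in> defd P"
    and right_id: "\<lbrakk>(x, y) \<in> defd P; y \<in> ids P\<rbrakk> \<Longrightarrow> x = x \<diamondop> y"
    and left_id: "\<lbrakk>(y, x) \<in> defd P; y \<in> ids P\<rbrakk> \<Longrightarrow> x = y \<diamondop> x"


section \<open>Complete semirings\<close>

text \<open>
  The sum of the family \<open>(f i)\<close>, \<open>i \<in> J\<close>, is \<open>Sm J f\<close>. Since HOL cannot quantify over all types,
  the index sets \<open>J\<close> range over the subsets of a type \<^typ>\<open>'i\<close>, which is a free type variable.

  These axioms together with \<open>x \<oplus> x = x\<close> do not force \<open>x \<oplus> x \<oplus> x \<oplus> \<dots> = x\<close>: on the chain
  \<open>0 < 1 < \<infinity>\<close> with \<open>x \<oplus> y = max x y\<close>, \<open>0\<close> annihilating, \<open>1\<close> neutral and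
  \<open>\<infinity> \<otimes> \<infinity> = \<infinity>\<close>, let a sum with infinitely many nonzero terms be \<open>\<infinity>\<close> and any other sum the
  maximum of its terms. For the function algebra to be a Kleene algebra, countable sums have to be
  suprema, so that countable idempotency must be required in addition.
\<close>

locale complete_semiring = semiring R for R :: "('s, 'm) ring_scheme" (structure) +
  fixes Sm :: "'i set \<Rightarrow> ('i \<Rightarrow> 's) \<Rightarrow> 's"
  assumes Sm_closed: "f \<in> J \<rightarrow> carrier R \<Longrightarrow> Sm J f \<in> carrier R"
    and Sm_cong: "\<lbrakk>f \<in> J \<rightarrow> carrier R; \<And>i. i \<in> J \<Longrightarrow> f i = g i\<rbrakk> \<Longrightarrow> Sm J f = Sm J g"
    and Sm_finite: "\<lbrakk>finite J; f \<in> J \<rightarrow> carrier R\<rbrakk> \<Longrightarrow> Sm J f = finsum R f J"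
    and Sm_reindex: "\<lbrakk>bij_betw h J L; f \<in> L \<rightarrow> carrier R\<rbrakk> \<Longrightarrow> Sm J (\<lambda>i. f (h i)) = Sm L f"
    and Sm_partition: "\<lbrakk>disjoint_family_on A L; f \<in> (\<Union>k \<in> L. A k) \<rightarrow> carrier R\<rbrakk> \<Longrightarrow>
      Sm L (\<lambda>k. Sm (A k) f) = Sm (\<Union>k \<in> L. A k) f"
    and Sm_distrib_left: "\<lbrakk>x \<in> carrier R; f \<in> J \<rightarrow> carrier R\<rbrakk> \<Longrightarrow>
      x \<otimes> Sm J f = Sm J (\<lambda>i. x \<otimes> f i)"
    and Sm_distrib_right: "\<lbrakk>x \<in> carrier R; f \<in> J \<rightarrow> carrier R\<rbrakk> \<Longrightarrow>
      Sm J f \<otimes> x = Sm J (\<lambda>i. f i \<otimes> x)"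

text \<open>
  The sum of a family whose index set \<open>J\<close> lives in another type \<^typ>\<open>'j\<close> is obtained by reindexing
  along an injection of \<open>J\<close> into \<^typ>\<open>'i\<close>; it is meaningful only if there is one, and then the
  choice is irrelevant.
\<close>

definition fam_sum :: "('i set \<Rightarrow> ('i \<Rightarrow> 's) \<Rightarrow> 's) \<Rightarrow> 'j set \<Rightarrow> ('j \<Rightarrow> 's) \<Rightarrow> 's" where
  "fam_sum Sm J f =
    (let e = (SOME e :: 'j \<Rightarrow> 'i. inj_on e J) in Sm (e ` J) (\<lambda>i. f (the_inv_into J e i)))"

lemma (in complete_semiring) fam_sum_eq:
  fixes e :: "'j \<Rightarrow> 'i"
  assumes e: "inj_on e J" and f: "f \<in> J \<rightarrow> carrier R"
  shows "fam_sum Sm J f = Sm (e ` J) (\<lambda>i. f (the_inv_into J e i))"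
proof -
  define d where "d = (SOME e :: 'j \<Rightarrow> 'i. inj_on e J)"
  have d: "inj_on d J"
    unfolding d_def using e by (rule someI[of "\<lambda>e. inj_on e J"])
  define h where "h = (\<lambda>i. e (the_inv_into J d i))"
  have h: "bij_betw h (d ` J) (e ` J)"
    unfolding h_def
    using bij_betw_trans[OF bij_betw_the_inv_into[OF inj_on_imp_bij_betw[OF d]]
        inj_on_imp_bij_betw[OF e]]
    by (simp add: comp_def)
  have fe: "(\<lambda>i. f (the_inv_into J e i)) \<in> e ` J \<rightarrow> carrier R"
    using f e by (auto simp: the_inv_into_f_f)
  have "fam_sum Sm J f = Sm (d ` J) (\<lambda>i. f (the_inv_into J d i))"
    by (simp add: fam_sum_def d_def Let_def)
  also have "\<dots> = Sm (d ` J) (\<lambda>i. f (the_inv_into J e (h i)))"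
    by (rule Sm_cong) (use f d e in \<open>auto simp: h_def the_inv_into_f_f\<close>)
  also have "\<dots> = Sm (e ` J) (\<lambda>i. f (the_inv_into J e i))"
    using Sm_reindex[OF h fe] .
  finally show ?thesis .
qed


section \<open>The algebra of functions from a partial semigroup to a complete semiring\<close>

context
  fixes P :: "('g, 'p) psemigroup_scheme"
    and S :: "('s, 'm) ring_scheme"
    and Sm :: "'i set \<Rightarrow> ('i \<Rightarrow> 's) \<Rightarrow> 's"
begin

definition fun_one :: "'g \<Rightarrow> 's" where
  "fun_one = (\<lambda>x \<in> carrier P. if x \<in> ids P then \<one>\<^bsub>S\<^esub> else \<zero>\<^bsub>S\<^esub>)"

definition fun_zero :: "'g \<Rightarrow> 's" where
  "fun_zero = (\<lambda>x \<in> carrier P. \<zero>\<^bsub>S\<^esub>)"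

definition fun_add :: "('g \<Rightarrow> 's) \<Rightarrow> ('g \<Rightarrow> 's) \<Rightarrow> 'g \<Rightarrow> 's" where
  "fun_add l l' = (\<lambda>x \<in> carrier P. l x \<oplus>\<^bsub>S\<^esub> l' x)"

definition fun_mult :: "('g \<Rightarrow> 's) \<Rightarrow> ('g \<Rightarrow> 's) \<Rightarrow> 'g \<Rightarrow> 's" where
  "fun_mult l l' = (\<lambda>x \<in> carrier P.
    fam_sum Sm {(y, z). (y, z) \<in> defd P \<and> y \<diamondop>\<^bsub>P\<^esub> z = x} (\<lambda>(y, z). l y \<otimes>\<^bsub>S\<^esub> l' z))"

primrec fun_pow :: "('g \<Rightarrow> 's) \<Rightarrow> nat \<Rightarrow> 'g \<Rightarrow> 's" where
  "fun_pow l 0 = fun_one"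
| "fun_pow l (Suc n) = fun_mult (fun_pow l n) l"

definition fun_star :: "('g \<Rightarrow> 's) \<Rightarrow> 'g \<Rightarrow> 's" where
  "fun_star l = (\<lambda>x \<in> carrier P. fam_sum Sm (UNIV :: nat set) (\<lambda>n. fun_pow l n x))"

text \<open>
  For \<open>{1, 0}\<close>-valued functions, ``the value is \<open>1\<close> only on identities'' is expressed as ``the value
  is \<open>0\<close> off identities''. This matters only if \<open>1 = 0\<close>, where the former may leave no tests at all.
\<close>

definition fun_tests :: "('g \<Rightarrow> 's) set" where
  "fun_tests = {l \<in> carrier P \<rightarrow>\<^sub>E carrier S.
    (\<forall>x \<in> carrier P. l x \<in> {\<one>\<^bsub>S\<^esub>, \<zero>\<^bsub>S\<^esub>}) \<and> (\<forall>x \<in> carrier P. x \<notin> ids P \<longrightarrow> l x = \<zero>\<^bsub>S\<^esub>)}"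

lemma fun_tests_eq:
  assumes "\<one>\<^bsub>S\<^esub> \<noteq> \<zero>\<^bsub>S\<^esub> \<or> ids P = carrier P"
  shows "fun_tests = {l \<in> carrier P \<rightarrow>\<^sub>E carrier S.
    (\<forall>x \<in> carrier P. l x \<in> {\<one>\<^bsub>S\<^esub>, \<zero>\<^bsub>S\<^esub>}) \<and> (\<forall>x \<in> carrier P. l x = \<one>\<^bsub>S\<^esub> \<longrightarrow> x \<in> ids P)}"
  unfolding fun_tests_def using assms by (intro Collect_cong) fastforce

definition fun_weights :: "('g \<Rightarrow> 's) set" where
  "fun_weights = {l \<in> carrier P \<rightarrow>\<^sub>E carrier S.
    (\<forall>x \<in> carrier P. x \<notin> ids P \<longrightarrow> l x = \<zero>\<^bsub>S\<^esub>) \<and> (\<forall>y \<in> ids P. \<forall>z \<in> ids P. l y = l z)}"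

definition fun_compl :: "('g \<Rightarrow> 's) \<Rightarrow> 'g \<Rightarrow> 's" where
  "fun_compl l = (\<lambda>x \<in> carrier P. if x \<in> ids P \<and> l x \<noteq> \<one>\<^bsub>S\<^esub> then \<one>\<^bsub>S\<^esub> else \<zero>\<^bsub>S\<^esub>)"

definition fun_kawt :: "('g \<Rightarrow> 's) kawt" where
  "fun_kawt =
    \<lparr>carrier = carrier P \<rightarrow>\<^sub>E carrier S, mult = fun_mult, one = fun_one, zero = fun_zero,
     add = fun_add, star = fun_star, tests = fun_tests, weights = fun_weights,
     test_compl = fun_compl\<rparr>"

end

end

theory Submission
  imports Defs
begin

text \<open>
  Fubini for infinite sums makes convolution associative: both bracketings are the sum over all
  factorizations of the argument into three factors. The left and right identities of an element
  of a partial semigroup are unique, so convolution with a function supported on the identities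
  is a scaling; this gives the unit laws and makes the algebra of tests and the algebra of
  weights pointwise. Countable idempotency turns countable sums into suprema, so that
  \<open>x y\<^sup>* z = \<Sum>\<^sub>n x y\<^sup>n z\<close> is a pointwise supremum, and the Kleene algebra axioms for the star follow
  from star-continuity alone.
\<close>

section \<open>Sums over arbitrary small index sets\<close>

text \<open>The axioms on \<open>Sm\<close> speak of one index type \<open>'i\<close>, while the
  proof sums over factorizations, over pairs of factorizations, over \<open>nat\<close> and over
  \<open>bool\<close>. All of these are handled by \<open>fam_sum\<close>, which makes sense for
  index sets that inject into \<open>'i\<close>. Taking \<open>'i\<close> infinite closes this class
  under products, since an infinite cardinal equals its square, so double sums stay within reach;
  the bound on \<open>carrier P\<close> then covers every convolution sum. Even binary addition is
  rewritten as a sum over \<open>bool\<close>, so that additivity and the splitting of a sum become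
  instances of Fubini. The order enters only through sums over \<open>nat\<close>: sums over
  factorizations may be uncountable and are treated purely algebraically, never as suprema.\<close>

locale infinitary_semiring = complete_semiring R Sm
  for R :: "('s, 'm) ring_scheme" (structure) and Sm :: "'i set \<Rightarrow> ('i \<Rightarrow> 's) \<Rightarrow> 's" +
  assumes infinite_index: "infinite (UNIV :: 'i set)"
begin

text \<open>This is the condition under which the choice of an injection in \<open>fam_sum\<close>
  succeeds.\<close>

definition small :: "'j set \<Rightarrow> bool" where
  "small J \<longleftrightarrow> J \<lesssim> (UNIV :: 'i set)"

lemma small_subset: "small J \<Longrightarrow> L \<subseteq> J \<Longrightarrow> small L"
  unfolding small_def by (blast intro: lepoll_trans subset_imp_lepoll)

lemma small_finite: "finite J \<Longrightarrow> small J"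
  unfolding small_def using infinite_index by (rule finite_lepoll_infinite)

lemma small_nat: "small (J :: nat set)"
proof -
  have "small (UNIV :: nat set)"
    unfolding small_def using infinite_index by (simp add: infinite_le_lepoll)
  then show ?thesis
    by (rule small_subset) simp
qed

text \<open>An infinite type is equipotent to its square, so two encodings into \<open>'i\<close>
  combine into one.\<close>

lemma small_times:
  assumes "small J" "small L"
  shows "small (J \<times> L)"
proof -
  have "J \<times> L \<lesssim> (UNIV :: 'i set) \<times> (UNIV :: 'i set)"
    using assms unfolding small_def by (rule times_lepoll_mono)
  also have "\<dots> \<approx> (UNIV :: 'i set)"
    using card_of_Times_same_infinite[OF infinite_index] by (simp add: eqpoll_iff_card_of_ordIso)
  finally show ?thesis
    unfolding small_def .
qed

text \<open>The fibres are bounded by one common small set, which places the whole sum type inside a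
  product.\<close>

lemma small_Sigma:
  assumes "small J" "small L" "\<And>j. j \<in> J \<Longrightarrow> A j \<subseteq> L"
  shows "small (Sigma J A)"
  by (rule small_subset[OF small_times[OF assms(1,2)]]) (use assms(3) in auto)

lemma smallE:
  assumes "small J"
  obtains e :: "'j \<Rightarrow> 'i" where "inj_on e (J :: 'j set)"
  using assms unfolding small_def lepoll_def by blast

section \<open>Transfer of the axioms on sums to small index sets of any type\<close>

lemma fam_sum_closed:
  fixes J :: "'j set"
  assumes "small J" and f: "f \<in> J \<rightarrow> carrier R"
  shows "fam_sum Sm J f \<in> carrier R"
proof -
  obtain e :: "'j \<Rightarrow> 'i" where e: "inj_on e J"
    using assms(1) by (rule smallE)
  show ?thesis
    unfolding fam_sum_eq[OF e f]
    by (rule Sm_closed) (use e f in \<open>auto simp: the_inv_into_f_f\<close>)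
qed

lemma fam_sum_cong:
  fixes J :: "'j set"
  assumes "small J" and f: "f \<in> J \<rightarrow> carrier R" and fg: "\<And>i. i \<in> J \<Longrightarrow> f i = g i"
  shows "fam_sum Sm J f = fam_sum Sm J g"
proof -
  obtain e :: "'j \<Rightarrow> 'i" where e: "inj_on e J"
    using assms(1) by (rule smallE)
  have g: "g \<in> J \<rightarrow> carrier R"
    using f fg by (auto simp: Pi_iff)
  show ?thesis
    unfolding fam_sum_eq[OF e f] fam_sum_eq[OF e g]
    by (rule Sm_cong) (use e f fg in \<open>auto simp: the_inv_into_f_f\<close>)
qed

text \<open>If \<open>e\<close> encodes \<open>L\<close>, then \<open>e \<circ> h\<close> encodes
  \<open>J\<close> with the same image in \<open>'i\<close>. By independence of the encoding, both
  sides are one and the same \<open>Sm\<close> sum.\<close>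

lemma fam_sum_reindex:
  fixes L :: "'j set"
  assumes "small L" and h: "bij_betw h J L" and f: "f \<in> L \<rightarrow> carrier R"
  shows "fam_sum Sm J (\<lambda>i. f (h i)) = fam_sum Sm L f"
proof -
  obtain e :: "'j \<Rightarrow> 'i" where e: "inj_on e L"
    using assms(1) by (rule smallE)
  have hJ: "h ` J = L" "inj_on h J"
    using h by (auto simp: bij_betw_def)
  have eh: "inj_on (e \<circ> h) J"
    using e hJ by (auto intro: comp_inj_on)
  have fh: "(\<lambda>i. f (h i)) \<in> J \<rightarrow> carrier R"
    using f hJ by auto
  have inv: "the_inv_into J (e \<circ> h) (e (h i)) = i" if "i \<in> J" for i
    using the_inv_into_f_f[OF eh that] by simp
  have img: "(e \<circ> h) ` J = e ` L"
    using hJ by auto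
  have "Sm ((e \<circ> h) ` J) (\<lambda>i. f (h (the_inv_into J (e \<circ> h) i))) =
      Sm ((e \<circ> h) ` J) (\<lambda>i. f (the_inv_into L e i))"
    by (rule Sm_cong) (use e hJ f in \<open>auto simp: inv the_inv_into_f_f\<close>)
  then show ?thesis
    unfolding fam_sum_eq[OF eh fh] fam_sum_eq[OF e f] img .
qed

lemma fam_sum_finite:
  fixes J :: "'j set"
  assumes "finite J" and f: "f \<in> J \<rightarrow> carrier R"
  shows "fam_sum Sm J f = finsum R f J"
proof -
  obtain e :: "'j \<Rightarrow> 'i" where e: "inj_on e J"
    using small_finite[OF assms(1)] by (rule smallE)
  have fe: "(\<lambda>i. f (the_inv_into J e i)) \<in> e ` J \<rightarrow> carrier R"
    using f e by (auto simp: the_inv_into_f_f)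
  have "fam_sum Sm J f = finsum R (\<lambda>i. f (the_inv_into J e i)) (e ` J)"
    unfolding fam_sum_eq[OF e f] using fe assms(1) by (simp add: Sm_finite)
  also have "\<dots> = finsum R (\<lambda>i. f (the_inv_into J e (e i))) J"
    using fe e by (rule finsum_reindex)
  also have "\<dots> = finsum R f J"
    by (rule finsum_cong') (use e f in \<open>auto simp: the_inv_into_f_f\<close>)
  finally show ?thesis .
qed

lemma fam_sum_singleton: "f j \<in> carrier R \<Longrightarrow> fam_sum Sm {j} f = f j"
  by (subst fam_sum_finite) auto

text \<open>Binary addition becomes a family sum, to which Fubini applies.\<close>

lemma fam_sum_bool:
  assumes "f \<in> UNIV \<rightarrow> carrier R"
  shows "fam_sum Sm (UNIV :: bool set) f = f True \<oplus> f False"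
proof -
  have "f True \<in> carrier R" "f False \<in> carrier R"
    using assms by auto
  then show ?thesis
    by (subst fam_sum_finite) (auto simp: UNIV_bool a_comm)
qed

text \<open>Fubini. The partition axiom needs disjoint subsets of \<open>'i\<close> as fibres.
  Injectivity of an encoding \<open>e\<close> of all pairs provides them: the fibre over
  \<open>k\<close> is encoded by \<open>e (k, _)\<close>, and independence of the encoding allows
  the inner sum to be computed with it.\<close>

lemma fam_sum_Sigma:
  fixes L :: "'j set" and A :: "'j \<Rightarrow> 'k set"
  assumes L: "small L" and S: "small (Sigma L A)"
    and f: "\<And>k a. k \<in> L \<Longrightarrow> a \<in> A k \<Longrightarrow> f k a \<in> carrier R"
  shows "fam_sum Sm L (\<lambda>k. fam_sum Sm (A k) (f k)) = fam_sum Sm (Sigma L A) (\<lambda>(k, a). f k a)"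
proof -
  obtain d :: "'j \<Rightarrow> 'i" where d: "inj_on d L"
    using L by (rule smallE)
  obtain e :: "'j \<times> 'k \<Rightarrow> 'i" where e: "inj_on e (Sigma L A)"
    using S by (rule smallE)
  \<comment> \<open>\<open>F\<close> is the double family transported to codes of pairs;
    \<open>A'\<close> sends the code of an outer index to the set of codes of the pairs above
    it.\<close>
  define F where "F = (\<lambda>i. case the_inv_into (Sigma L A) e i of (k, a) \<Rightarrow> f k a)"
  define A' where "A' = (\<lambda>i. (\<lambda>a. e (the_inv_into L d i, a)) ` A (the_inv_into L d i))"
  have F: "F (e (k, a)) = f k a" if "k \<in> L" "a \<in> A k" for k a
    using the_inv_into_f_f[OF e, of "(k, a)"] that by (simp add: F_def)
  have A': "A' (d k) = (\<lambda>a. e (k, a)) ` A k" if "k \<in> L" for k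
    using that d by (simp add: A'_def the_inv_into_f_f)
  \<comment> \<open>Smallness of each fibre is inherited from that of the set of pairs.\<close>
  have smallA: "small (A k)" if "k \<in> L" for k
  proof -
    have "inj_on (\<lambda>a. e (k, a)) (A k)"
      using e that by (auto simp: inj_on_def)
    then show ?thesis
      unfolding small_def lepoll_def by blast
  qed
  have inner: "fam_sum Sm (A k) (f k) = Sm (A' (d k)) F" if "k \<in> L" for k
  proof -
    have ek: "inj_on (\<lambda>a. e (k, a)) (A k)"
      using e that by (auto simp: inj_on_def)
    have fk: "f k \<in> A k \<rightarrow> carrier R"
      using f that by auto
    show ?thesis
      unfolding fam_sum_eq[OF ek fk] A'[OF that]
      by (rule Sm_cong) (use that f the_inv_into_f_f[OF ek] in \<open>auto simp: F\<close>)
  qed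
  have Un: "(\<Union>i \<in> d ` L. A' i) = e ` Sigma L A"
    using A' by auto
  have FU: "F \<in> (\<Union>i \<in> d ` L. A' i) \<rightarrow> carrier R"
    unfolding Un using F f by auto
  have disj: "disjoint_family_on A' (d ` L)"
    unfolding disjoint_family_on_def
  proof (intro ballI impI)
    fix i j assume "i \<in> d ` L" "j \<in> d ` L" "i \<noteq> j"
    then obtain k l where kl: "i = d k" "j = d l" "k \<in> L" "l \<in> L" "k \<noteq> l"
      by auto
    then have "e (k, a) \<noteq> e (l, b)" if "a \<in> A k" "b \<in> A l" for a b
      using e that by (auto dest: inj_onD)
    then show "A' i \<inter> A' j = {}"
      using kl A' by auto
  qed
  have inner_closed: "(\<lambda>k. fam_sum Sm (A k) (f k)) \<in> L \<rightarrow> carrier R"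
    using f smallA by (auto intro!: fam_sum_closed)
  have "fam_sum Sm L (\<lambda>k. fam_sum Sm (A k) (f k)) =
      Sm (d ` L) (\<lambda>i. fam_sum Sm (A (the_inv_into L d i)) (f (the_inv_into L d i)))"
    by (rule fam_sum_eq[OF d inner_closed])
  also have "\<dots> = Sm (d ` L) (\<lambda>i. Sm (A' i) F)"
    by (rule Sm_cong) (use inner inner_closed d in \<open>auto simp: the_inv_into_f_f\<close>)
  also have "\<dots> = Sm (e ` Sigma L A) F"
    using Sm_partition[OF disj FU] by (simp only: Un)
  also have "\<dots> = fam_sum Sm (Sigma L A) (\<lambda>(k, a). f k a)"
    by (subst fam_sum_eq[OF e]) (use f in \<open>auto simp: F_def\<close>)
  finally show ?thesis .
qed

text \<open>Both iterated sums flatten to a sum over a product, and \<open>prod.swap\<close> matches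
  the two products.\<close>

lemma fam_sum_swap:
  assumes L: "small L" and M: "small M"
    and f: "\<And>k a. k \<in> L \<Longrightarrow> a \<in> M \<Longrightarrow> f k a \<in> carrier R"
  shows "fam_sum Sm L (\<lambda>k. fam_sum Sm M (\<lambda>a. f k a)) = fam_sum Sm M (\<lambda>a. fam_sum Sm L (\<lambda>k. f k a))"
proof -
  have "fam_sum Sm L (\<lambda>k. fam_sum Sm M (f k)) = fam_sum Sm (L \<times> M) (\<lambda>(k, a). f k a)"
    using assms by (intro fam_sum_Sigma small_times) auto
  also have "\<dots> = fam_sum Sm (M \<times> L) (\<lambda>p. case prod.swap p of (k, a) \<Rightarrow> f k a)"
    by (rule fam_sum_reindex[symmetric])
      (use assms in \<open>auto intro: small_times simp: bij_betw_def inj_on_def\<close>)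
  also have "\<dots> = fam_sum Sm (M \<times> L) (\<lambda>(a, k). f k a)"
    by (simp add: case_prod_beta')
  also have "\<dots> = fam_sum Sm M (\<lambda>a. fam_sum Sm L (\<lambda>k. f k a))"
    using assms by (intro fam_sum_Sigma[symmetric] small_times) auto
  finally show ?thesis .
qed

text \<open>Writing each \<open>f i \<oplus> g i\<close> as a sum over \<open>bool\<close> turns
  additivity into an interchange of two sums.\<close>

lemma fam_sum_add:
  assumes J: "small J" and f: "f \<in> J \<rightarrow> carrier R" and g: "g \<in> J \<rightarrow> carrier R"
  shows "fam_sum Sm J (\<lambda>i. f i \<oplus> g i) = fam_sum Sm J f \<oplus> fam_sum Sm J g"
proof -
  have fg: "f i \<in> carrier R" "g i \<in> carrier R" if "i \<in> J" for i
    using f g that by auto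
  have "fam_sum Sm J (\<lambda>i. f i \<oplus> g i) =
      fam_sum Sm J (\<lambda>i. fam_sum Sm (UNIV :: bool set) (\<lambda>b. if b then f i else g i))"
    by (rule fam_sum_cong[OF J]) (use fg in \<open>auto simp: fam_sum_bool\<close>)
  also have "\<dots> = fam_sum Sm (UNIV :: bool set) (\<lambda>b. fam_sum Sm J (\<lambda>i. if b then f i else g i))"
    by (rule fam_sum_swap[OF J]) (use fg in \<open>auto intro: small_finite\<close>)
  also have "\<dots> = fam_sum Sm J f \<oplus> fam_sum Sm J g"
    by (subst fam_sum_bool) (use f g J in \<open>auto intro!: fam_sum_closed split: if_splits\<close>)
  finally show ?thesis .
qed

text \<open>\<open>J\<close> is the disjoint union of two fibres over \<open>bool\<close>, so Fubini
  followed by \<open>fam_sum_bool\<close> gives the two summands.\<close>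

lemma fam_sum_split:
  assumes J: "small J" and T: "T \<subseteq> J" and f: "f \<in> J \<rightarrow> carrier R"
  shows "fam_sum Sm J f = fam_sum Sm T f \<oplus> fam_sum Sm (J - T) f"
proof -
  define A where "A = (\<lambda>b. if b then T else J - T)"
  have AJ: "A b \<subseteq> J" for b
    using T by (auto simp: A_def)
  have small_A: "small (A b)" for b
    using J AJ by (rule small_subset)
  have closed: "fam_sum Sm (A b) f \<in> carrier R" for b
    by (rule fam_sum_closed[OF small_A]) (use f AJ in blast)
  have bij: "bij_betw snd (Sigma UNIV A) J"
    using T by (auto simp: bij_betw_def inj_on_def A_def image_iff split: if_splits)
  have "fam_sum Sm J f = fam_sum Sm (Sigma UNIV A) (\<lambda>p. f (snd p))"
    using fam_sum_reindex[OF J bij f] by simp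
  also have "\<dots> = fam_sum Sm (Sigma UNIV A) (\<lambda>(b, i). f i)"
    by (simp add: case_prod_beta')
  also have "\<dots> = fam_sum Sm (UNIV :: bool set) (\<lambda>b. fam_sum Sm (A b) f)"
    using J f AJ by (intro fam_sum_Sigma[symmetric] small_Sigma[OF _ J] small_finite) auto
  also have "\<dots> = fam_sum Sm T f \<oplus> fam_sum Sm (J - T) f"
    using closed by (subst fam_sum_bool) (auto simp: A_def)
  finally show ?thesis .
qed

lemma fam_sum_distrib_left:
  fixes J :: "'j set"
  assumes "small J" and x: "x \<in> carrier R" and f: "f \<in> J \<rightarrow> carrier R"
  shows "x \<otimes> fam_sum Sm J f = fam_sum Sm J (\<lambda>i. x \<otimes> f i)"
proof -
  obtain e :: "'j \<Rightarrow> 'i" where e: "inj_on e J"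
    using assms(1) by (rule smallE)
  have xf: "(\<lambda>i. x \<otimes> f i) \<in> J \<rightarrow> carrier R"
    using x f by auto
  show ?thesis
    unfolding fam_sum_eq[OF e f] fam_sum_eq[OF e xf]
    by (rule Sm_distrib_left[OF x]) (use e f in \<open>auto simp: the_inv_into_f_f\<close>)
qed

lemma fam_sum_distrib_right:
  fixes J :: "'j set"
  assumes "small J" and x: "x \<in> carrier R" and f: "f \<in> J \<rightarrow> carrier R"
  shows "fam_sum Sm J f \<otimes> x = fam_sum Sm J (\<lambda>i. f i \<otimes> x)"
proof -
  obtain e :: "'j \<Rightarrow> 'i" where e: "inj_on e J"
    using assms(1) by (rule smallE)
  have fx: "(\<lambda>i. f i \<otimes> x) \<in> J \<rightarrow> carrier R"
    using x f by auto
  show ?thesis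
    unfolding fam_sum_eq[OF e f] fam_sum_eq[OF e fx]
    by (rule Sm_distrib_right[OF x]) (use e f in \<open>auto simp: the_inv_into_f_f\<close>)
qed

text \<open>For infinite \<open>J\<close> this comes from distributivity: every term is
  \<open>\<zero> \<otimes> f i\<close>, and the factor \<open>\<zero>\<close> pulled out of the sum
  annihilates it.\<close>

lemma fam_sum_zero:
  assumes J: "small J" and f: "\<And>i. i \<in> J \<Longrightarrow> f i = \<zero>"
  shows "fam_sum Sm J f = \<zero>"
proof -
  have fJ: "f \<in> J \<rightarrow> carrier R"
    using f by auto
  have "fam_sum Sm J f = fam_sum Sm J (\<lambda>i. \<zero> \<otimes> f i)"
    by (rule fam_sum_cong[OF J fJ]) (use f in auto)
  also have "\<dots> = \<zero> \<otimes> fam_sum Sm J f"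
    using fam_sum_distrib_left[OF J _ fJ] by simp
  also have "\<dots> = \<zero>"
    using fam_sum_closed[OF J fJ] by simp
  finally show ?thesis .
qed

lemma fam_sum_single:
  assumes J: "small J" and j: "j \<in> J" "f j \<in> carrier R"
    and f: "\<And>i. i \<in> J \<Longrightarrow> i \<noteq> j \<Longrightarrow> f i = \<zero>"
  shows "fam_sum Sm J f = f j"
proof -
  have fJ: "f \<in> J \<rightarrow> carrier R"
    using j f by (metis Pi_I zero_closed)
  have "fam_sum Sm J f = fam_sum Sm {j} f \<oplus> fam_sum Sm (J - {j}) f"
    using j by (intro fam_sum_split[OF J _ fJ]) auto
  also have "fam_sum Sm (J - {j}) f = \<zero>"
    using f by (intro fam_sum_zero small_subset[OF J]) auto
  finally show ?thesis
    using j by (simp add: fam_sum_singleton)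
qed

end

locale countably_idem_semiring = infinitary_semiring R Sm + idem_semiring R
  for R :: "('s, 'm) ring_scheme" (structure) and Sm :: "'i set \<Rightarrow> ('i \<Rightarrow> 's) \<Rightarrow> 's" +
  assumes countable_idem: "x \<in> carrier R \<Longrightarrow> fam_sum Sm (UNIV :: nat set) (\<lambda>n. x) = x"
begin

text \<open>Once the \<open>n\<close>-th term is split off, binary idempotency absorbs a second copy
  of it.\<close>

lemma countable_sum_upper:
  assumes f: "\<And>n :: nat. f n \<in> carrier R"
  shows "f n \<oplus> fam_sum Sm UNIV f = fam_sum Sm UNIV f"
proof -
  have fU: "f \<in> UNIV \<rightarrow> carrier R"
    using f by auto
  have c: "fam_sum Sm (UNIV - {n}) f \<in> carrier R"
    using f by (intro fam_sum_closed small_nat) auto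
  have "fam_sum Sm UNIV f = f n \<oplus> fam_sum Sm (UNIV - {n}) f"
    using fam_sum_split[OF small_nat _ fU, of "{n}"] f by (simp add: fam_sum_singleton)
  then show ?thesis
    using c f[of n] by (simp add: a_assoc[symmetric] add_idem)
qed

text \<open>Here countable idempotency acts: the bound \<open>z\<close> equals the sum of countably
  many copies of itself, so \<open>z\<close> can be added to the family term by term.\<close>

lemma countable_sum_least:
  assumes f: "\<And>n :: nat. f n \<in> carrier R" and z: "z \<in> carrier R"
    and le: "\<And>n. f n \<oplus> z = z"
  shows "fam_sum Sm UNIV f \<oplus> z = z"
proof -
  have "fam_sum Sm UNIV f \<oplus> z = fam_sum Sm UNIV f \<oplus> fam_sum Sm (UNIV :: nat set) (\<lambda>n. z)"
    using z by (simp add: countable_idem)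
  also have "\<dots> = fam_sum Sm UNIV (\<lambda>n. f n \<oplus> z)"
    using f z by (intro fam_sum_add[symmetric] small_nat) auto
  finally show ?thesis
    using z by (simp add: le countable_idem)
qed

end


section \<open>Star-continuity and subsemirings\<close>

lemma le_nat_order [simp]: "x \<sqsubseteq>\<^bsub>nat_order K\<^esub> y \<longleftrightarrow> x \<oplus>\<^bsub>K\<^esub> y = y"
  and carrier_nat_order [simp]: "carrier (nat_order K) = carrier K"
  by (simp_all add: nat_order_def)

text \<open>Star-continuity makes \<open>x \<otimes> star K y \<otimes> z\<close> a least upper
  bound, so an inequality with such a product on the left reduces to the powers of \<open>y\<close>.
  The unfold laws then compare successive powers, and the induction laws become inductions on the
  exponent.\<close>

lemma kleene_algebra_if_star_continuous:
  fixes K :: "('a, 'm) star_ring_scheme" (structure)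
  assumes "idem_semiring K"
    and star: "\<And>x. x \<in> carrier K \<Longrightarrow> star K x \<in> carrier K"
    and cont: "star_continuous K"
  shows "kleene_algebra K"
proof -
  interpret idem_semiring K by fact
  have lub: "least (nat_order K) (x \<otimes> star K y \<otimes> z)
      (Upper (nat_order K) {x \<otimes> (y [^] n) \<otimes> z | n :: nat. True})"
    if "x \<in> carrier K" "y \<in> carrier K" "z \<in> carrier K" for x y z
    using cont that by (simp add: star_continuous_def)
  have upper: "x \<otimes> (y [^] n) \<otimes> z \<oplus> x \<otimes> star K y \<otimes> z = x \<otimes> star K y \<otimes> z"
    if "x \<in> carrier K" "y \<in> carrier K" "z \<in> carrier K" for x y z and n :: nat
  proof -
    have "x \<otimes> (y [^] n) \<otimes> z \<sqsubseteq>\<^bsub>nat_order K\<^esub> x \<otimes> star K y \<otimes> z"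
      by (rule least_Upper_above[OF lub[OF that]]) (use that in auto)
    then show ?thesis
      by simp
  qed
  have least: "x \<otimes> star K y \<otimes> z \<oplus> w = w"
    if xyz: "x \<in> carrier K" "y \<in> carrier K" "z \<in> carrier K" and w: "w \<in> carrier K"
      "\<And>n :: nat. x \<otimes> (y [^] n) \<otimes> z \<oplus> w = w" for x y z w
  proof -
    have "w \<in> Upper (nat_order K) {x \<otimes> (y [^] n) \<otimes> z | n :: nat. True}"
      using w unfolding Upper_def by auto
    then show ?thesis
      using least_le[OF lub[OF xyz]] by simp
  qed
  have pow_le: "x [^] n \<oplus> star K x = star K x" if "x \<in> carrier K" for x and n :: nat
    using upper[of \<one> x \<one> n] that star by simp
  have one_le: "\<one> \<oplus> star K x = star K x" if "x \<in> carrier K" for x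
    using pow_le[OF that, of 0] by simp
  have mult_mono: "x \<otimes> y \<oplus> x \<otimes> z = x \<otimes> z" "y \<otimes> x \<oplus> z \<otimes> x = z \<otimes> x"
    if "x \<in> carrier K" "y \<in> carrier K" "z \<in> carrier K" "y \<oplus> z = z" for x y z
    using that by (simp_all add: r_distr[symmetric] l_distr[symmetric])
  have le_trans: "x \<oplus> z = z" if "x \<oplus> y = y" "y \<oplus> z = z"
    "x \<in> carrier K" "y \<in> carrier K" "z \<in> carrier K" for x y z
    using that by (metis a_assoc)
  have summand: "x \<oplus> z = z" if "x \<oplus> y \<oplus> z = z"
    "x \<in> carrier K" "y \<in> carrier K" "z \<in> carrier K" for x y z
  proof -
    have "x \<oplus> z = x \<oplus> (x \<oplus> y \<oplus> z)"
      by (simp only: that(1))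
    also have "\<dots> = (x \<oplus> x) \<oplus> y \<oplus> z"
      using that(2-) by (simp add: a_assoc)
    also have "\<dots> = z"
      using that by (simp add: add_idem)
    finally show ?thesis .
  qed
  show ?thesis
  proof (unfold_locales, goal_cases)
    case (1 x)
    then show ?case by (rule star)
  next
    case (2 x)
    \<comment> \<open>Powers are defined by multiplication on the right, so the left unfold law
      needs the mirrored recursion \<open>nat_pow_Suc2\<close>.\<close>
    have "x \<otimes> x [^] n \<oplus> star K x = star K x" for n :: nat
      using pow_le[OF 2, of "Suc n"] unfolding nat_pow_Suc2[OF 2] .
    \<comment> \<open>The factor \<open>\<one>\<close> only supplies the third factor of the
      star-continuity law.\<close>
    then have "x \<otimes> star K x \<otimes> \<one> \<oplus> star K x = star K x"
      using 2 star by (intro least) auto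
    then show ?case
      using 2 star one_le by (simp add: a_assoc)
  next
    case (3 x)
    have "\<one> \<otimes> star K x \<otimes> x \<oplus> star K x = star K x"
      using 3 star pow_le[of x "Suc _"] by (intro least) auto
    then show ?case
      using 3 star one_le by (simp add: a_assoc)
  next
    case (4 x y z)
    have y: "y \<oplus> z = z" and xz: "x \<otimes> z \<oplus> z = z"
      using summand[of y "x \<otimes> z" z] summand[of "x \<otimes> z" y z] 4 by (simp_all add: a_comm)
    have "x [^] n \<otimes> y \<oplus> z = z" for n :: nat
    proof (induction n)
      case 0
      then show ?case using 4 y by simp
    next
      case (Suc n)
      have "x \<otimes> (x [^] n \<otimes> y) \<oplus> x \<otimes> z = x \<otimes> z"
        using Suc 4 by (intro mult_mono) auto
      then have "x \<otimes> (x [^] n \<otimes> y) \<oplus> z = z"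
        using 4 by (intro le_trans[OF _ xz]) auto
      then show ?case
        unfolding nat_pow_Suc2[OF 4(1)] using 4 by (simp add: m_assoc)
    qed
    then show ?case
      using least[of \<one> x y z] 4 star by simp
  next
    case (5 x y z)
    have y: "y \<oplus> z = z" and zx: "z \<otimes> x \<oplus> z = z"
      using summand[of y "z \<otimes> x" z] summand[of "z \<otimes> x" y z] 5 by (simp_all add: a_comm)
    have "y \<otimes> x [^] n \<oplus> z = z" for n :: nat
    proof (induction n)
      case 0
      then show ?case using 5 y by simp
    next
      case (Suc n)
      have "(y \<otimes> x [^] n) \<otimes> x \<oplus> z \<otimes> x = z \<otimes> x"
        using Suc 5 by (intro mult_mono) auto
      then have "(y \<otimes> x [^] n) \<otimes> x \<oplus> z = z"
        using 5 by (intro le_trans[OF _ zx]) auto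
      then show ?case
        using 5 by (simp add: m_assoc)
    qed
    then show ?case
      using least[of y x \<one> z] 5 star by simp
  qed
qed

lemma (in semiring) semiring_subset:
  assumes "W \<subseteq> carrier R" "\<one> \<in> W" "\<zero> \<in> W"
    and "\<And>x y. x \<in> W \<Longrightarrow> y \<in> W \<Longrightarrow> x \<oplus> y \<in> W"
    and "\<And>x y. x \<in> W \<Longrightarrow> y \<in> W \<Longrightarrow> x \<otimes> y \<in> W"
  shows "semiring \<lparr>carrier = W, mult = mult R, one = \<one>, zero = \<zero>, add = add R\<rparr>"
  using assms
  by (intro semiring.intro abelian_monoidI monoidI semiring_axioms.intro)
    (auto simp: subset_iff a_assoc m_assoc l_distr r_distr intro: a_comm)


section \<open>The algebra of functions on a partial semigroup\<close>

context partial_semigroup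
begin

section \<open>Identities of a partial semigroup\<close>

lemma ids_nonempty: "ids P \<noteq> {}"
  using nonempty left_id_ex by blast

text \<open>Since \<open>x = d \<diamondop> x\<close>, the product of \<open>e\<close> with
  \<open>d \<diamondop> x\<close> is defined, hence so is \<open>e \<diamondop> d\<close>. Two
  composable identities are both equal to their product.\<close>

lemma left_id_unique:
  assumes "(e, x) \<in> defd P" "e \<in> ids P" "(d, x) \<in> defd P" "d \<in> ids P"
  shows "e = d"
proof -
  have "x = d \<diamondop> x"
    using assms left_id by blast
  then have "(e, d) \<in> defd P"
    using assms defd_assoc[of e d x] defd_subset by auto
  then show ?thesis
    using assms left_id right_id by metis
qed

lemma right_id_unique:
  assumes "(x, e) \<in> defd P" "e \<in> ids P" "(x, d) \<in> defd P" "d \<in> ids P"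
  shows "e = d"
proof -
  have "x = x \<diamondop> e"
    using assms right_id by blast
  then have "(e, d) \<in> defd P"
    using assms defd_assoc[of x e d] defd_subset by auto
  then show ?thesis
    using assms left_id right_id by metis
qed

text \<open>A left identity \<open>d\<close> of \<open>e\<close> is composable with the identity
  \<open>e\<close>, so \<open>d\<close> and \<open>e\<close> both equal
  \<open>d \<diamondop> e\<close>.\<close>

lemma id_defd: "e \<in> ids P \<Longrightarrow> (e, e) \<in> defd P"
  using left_id_ex[of e] ids_subset left_id right_id by (metis subsetD)

section \<open>Factorizations into two and three factors\<close>

definition splits :: "'g \<Rightarrow> ('g \<times> 'g) set" where
  "splits x = {(y, z). (y, z) \<in> defd P \<and> y \<diamondop> z = x}"

lemma splits_closed: "p \<in> splits x \<Longrightarrow> fst p \<in> carrier P \<and> snd p \<in> carrier P"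
  using defd_subset by (auto simp: splits_def)

definition splits3 :: "'g \<Rightarrow> ('g \<times> 'g \<times> 'g) set" where
  "splits3 x = {(a, b, c). (a, b) \<in> defd P \<and> (a \<diamondop> b, c) \<in> defd P \<and> (a \<diamondop> b) \<diamondop> c = x}"

text \<open>The pairs are the index set of the iterated sum in
  \<open>(l \<star> m) \<star> n\<close>. Their component \<open>a \<diamondop> b\<close> is
  determined by the rest, so the inverse forgets it.\<close>

lemma splits3_left:
  "bij_betw (\<lambda>(a, b, c). ((a \<diamondop> b, c), (a, b))) (splits3 x) (SIGMA p:splits x. splits (fst p))"
  by (rule bij_betw_byWitness[where f' = "\<lambda>((u, c), (a, b)). (a, b, c)"])
    (auto simp: splits_def splits3_def)

text \<open>By the two associativity axioms the set of triples is the same for either bracketing.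
  Outside the carrier, where those axioms are silent, both sides fail because \<open>defd P\<close>
  lies in the square of the carrier.\<close>

lemma splits3_iff:
  "(a, b, c) \<in> splits3 x \<longleftrightarrow> (b, c) \<in> defd P \<and> (a, b \<diamondop> c) \<in> defd P \<and> a \<diamondop> (b \<diamondop> c) = x"
proof (cases "a \<in> carrier P \<and> b \<in> carrier P \<and> c \<in> carrier P")
  case True
  then show ?thesis
    using defd_assoc[of a b c] pmult_assoc[of a b c] by (auto simp: splits3_def)
next
  case False
  then show ?thesis
    using defd_subset by (auto simp: splits3_def)
qed

lemma splits3_right:
  "bij_betw (\<lambda>(a, b, c). ((a, b \<diamondop> c), (b, c))) (splits3 x) (SIGMA p:splits x. splits (snd p))"
  by (rule bij_betw_byWitness[where f' = "\<lambda>((a, w), (b, c)). (a, b, c)"])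
    (auto simp: splits_def splits3_iff)

end

locale function_algebra = P: partial_semigroup P + countably_idem_semiring S Sm
  for P :: "('g, 'p) psemigroup_scheme" and S :: "('s, 'm) ring_scheme" (structure)
    and Sm :: "'i set \<Rightarrow> ('i \<Rightarrow> 's) \<Rightarrow> 's" +
  assumes small_carrier: "small (carrier P)"
begin

abbreviation Fun :: "('g \<Rightarrow> 's) set" where
  "Fun \<equiv> carrier P \<rightarrow>\<^sub>E carrier S"

abbreviation conv :: "('g \<Rightarrow> 's) \<Rightarrow> ('g \<Rightarrow> 's) \<Rightarrow> 'g \<Rightarrow> 's" (infixl \<open>\<star>\<close> 70) where
  "l \<star> m \<equiv> fun_mult P S Sm l m"

abbreviation padd :: "('g \<Rightarrow> 's) \<Rightarrow> ('g \<Rightarrow> 's) \<Rightarrow> 'g \<Rightarrow> 's" (infixl \<open>\<boxplus>\<close> 65) where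
  "l \<boxplus> m \<equiv> fun_add P S l m"

lemma Fun_eqI: "l \<in> Fun \<Longrightarrow> m \<in> Fun \<Longrightarrow> (\<And>x. x \<in> carrier P \<Longrightarrow> l x = m x) \<Longrightarrow> l = m"
  by (rule PiE_ext)

lemma small_splits: "small (P.splits x)"
  by (rule small_subset[OF small_times[OF small_carrier small_carrier]])
    (use P.defd_subset in \<open>auto simp: P.splits_def\<close>)

lemma conv_apply:
  "x \<in> carrier P \<Longrightarrow> (l \<star> m) x = fam_sum Sm (P.splits x) (\<lambda>p. l (fst p) \<otimes> m (snd p))"
  by (simp add: fun_mult_def P.splits_def case_prod_beta')

lemma Fun_apply: "l \<in> Fun \<Longrightarrow> x \<in> carrier P \<Longrightarrow> l x \<in> carrier S"
  by auto

lemma Fun_fst: "l \<in> Fun \<Longrightarrow> p \<in> P.splits x \<Longrightarrow> l (fst p) \<in> carrier S"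
  and Fun_snd: "l \<in> Fun \<Longrightarrow> p \<in> P.splits x \<Longrightarrow> l (snd p) \<in> carrier S"
  using P.splits_closed by (auto simp: PiE_iff)

lemma conv_closed: "l \<in> Fun \<Longrightarrow> m \<in> Fun \<Longrightarrow> l \<star> m \<in> Fun"
proof -
  assume l: "l \<in> Fun" and m: "m \<in> Fun"
  have "(l \<star> m) x \<in> carrier S" if "x \<in> carrier P" for x
    unfolding conv_apply[OF that]
    by (rule fam_sum_closed[OF small_splits]) (use Fun_fst[OF l] Fun_snd[OF m] in auto)
  then show ?thesis
    by (auto simp: PiE_iff fun_mult_def)
qed

lemma add_closed: "l \<in> Fun \<Longrightarrow> m \<in> Fun \<Longrightarrow> l \<boxplus> m \<in> Fun"
  and add_apply: "x \<in> carrier P \<Longrightarrow> (l \<boxplus> m) x = l x \<oplus> m x"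
  by (auto simp: fun_add_def PiE_iff)

lemma fun_zero_closed: "fun_zero P S \<in> Fun"
  and fun_zero_apply: "x \<in> carrier P \<Longrightarrow> fun_zero P S x = \<zero>"
  by (auto simp: fun_zero_def)

lemma fun_one_closed: "fun_one P S \<in> Fun"
  and fun_one_apply: "x \<in> carrier P \<Longrightarrow> fun_one P S x = (if x \<in> ids P then \<one> else \<zero>)"
  by (auto simp: fun_one_def)

text \<open>Right distributivity moves \<open>n\<close> into the inner sum, Fubini flattens the
  double sum, and \<open>splits3_left\<close> reindexes it by triples.\<close>

lemma conv_assoc_left:
  assumes l: "l \<in> Fun" and m: "m \<in> Fun" and n: "n \<in> Fun" and x: "x \<in> carrier P"
  shows "((l \<star> m) \<star> n) x = fam_sum Sm (P.splits3 x) (\<lambda>(a, b, c). l a \<otimes> m b \<otimes> n c)"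
proof -
  let ?f = "\<lambda>p q. l (fst q) \<otimes> m (snd q) \<otimes> n (snd p)"
  let ?S = "SIGMA p:P.splits x. P.splits (fst p)"
  have small: "small ?S"
    by (rule small_Sigma[OF small_splits small_times[OF small_carrier small_carrier]])
      (use P.splits_closed in fastforce)
  have f: "?f p q \<in> carrier S" if "p \<in> P.splits x" "q \<in> P.splits (fst p)" for p q
    using that Fun_fst[OF l] Fun_snd[OF m] Fun_snd[OF n] by simp
  have "((l \<star> m) \<star> n) x = fam_sum Sm (P.splits x) (\<lambda>p. (l \<star> m) (fst p) \<otimes> n (snd p))"
    by (rule conv_apply[OF x])
  also have "\<dots> = fam_sum Sm (P.splits x) (\<lambda>p. fam_sum Sm (P.splits (fst p)) (?f p))"
  proof (rule fam_sum_cong[OF small_splits])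
    show "(\<lambda>p. (l \<star> m) (fst p) \<otimes> n (snd p)) \<in> P.splits x \<rightarrow> carrier S"
      using Fun_fst[OF conv_closed[OF l m]] Fun_snd[OF n] by auto
  next
    fix p assume p: "p \<in> P.splits x"
    show "(l \<star> m) (fst p) \<otimes> n (snd p) = fam_sum Sm (P.splits (fst p)) (?f p)"
      unfolding conv_apply[OF P.splits_closed[OF p, THEN conjunct1]]
      by (rule fam_sum_distrib_right[OF small_splits Fun_snd[OF n p]])
        (use Fun_fst[OF l] Fun_snd[OF m] in auto)
  qed
  also have "\<dots> = fam_sum Sm ?S (\<lambda>(p, q). ?f p q)"
    by (rule fam_sum_Sigma[OF small_splits small f])
  also have "\<dots> = fam_sum Sm (P.splits3 x)
      (\<lambda>t. case (case t of (a, b, c) \<Rightarrow> ((a \<diamondop>\<^bsub>P\<^esub> b, c), (a, b))) of (p, q) \<Rightarrow> ?f p q)"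
    by (rule fam_sum_reindex[OF small P.splits3_left, symmetric]) (use f in auto)
  also have "\<dots> = fam_sum Sm (P.splits3 x) (\<lambda>(a, b, c). l a \<otimes> m b \<otimes> n c)"
    by (simp add: case_prod_beta')
  finally show ?thesis .
qed

lemma conv_assoc_right:
  assumes l: "l \<in> Fun" and m: "m \<in> Fun" and n: "n \<in> Fun" and x: "x \<in> carrier P"
  shows "(l \<star> (m \<star> n)) x = fam_sum Sm (P.splits3 x) (\<lambda>(a, b, c). l a \<otimes> m b \<otimes> n c)"
proof -
  let ?f = "\<lambda>p q. l (fst p) \<otimes> m (fst q) \<otimes> n (snd q)"
  let ?S = "SIGMA p:P.splits x. P.splits (snd p)"
  have small: "small ?S"
    by (rule small_Sigma[OF small_splits small_times[OF small_carrier small_carrier]])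
      (use P.splits_closed in fastforce)
  have f: "?f p q \<in> carrier S" if "p \<in> P.splits x" "q \<in> P.splits (snd p)" for p q
    using that Fun_fst[OF l] Fun_fst[OF m] Fun_snd[OF n] by simp
  have "(l \<star> (m \<star> n)) x = fam_sum Sm (P.splits x) (\<lambda>p. l (fst p) \<otimes> (m \<star> n) (snd p))"
    by (rule conv_apply[OF x])
  also have "\<dots> = fam_sum Sm (P.splits x) (\<lambda>p. fam_sum Sm (P.splits (snd p)) (?f p))"
  proof (rule fam_sum_cong[OF small_splits])
    show "(\<lambda>p. l (fst p) \<otimes> (m \<star> n) (snd p)) \<in> P.splits x \<rightarrow> carrier S"
      using Fun_snd[OF conv_closed[OF m n]] Fun_fst[OF l] by auto
  next
    fix p assume p: "p \<in> P.splits x"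
    have mn: "(\<lambda>q. m (fst q) \<otimes> n (snd q)) \<in> P.splits (snd p) \<rightarrow> carrier S"
      using Fun_fst[OF m] Fun_snd[OF n] by auto
    have "l (fst p) \<otimes> (m \<star> n) (snd p) =
        fam_sum Sm (P.splits (snd p)) (\<lambda>q. l (fst p) \<otimes> (m (fst q) \<otimes> n (snd q)))"
      unfolding conv_apply[OF P.splits_closed[OF p, THEN conjunct2]]
      by (rule fam_sum_distrib_left[OF small_splits Fun_fst[OF l p] mn])
    \<comment> \<open>Rebracketing in \<open>S\<close> brings the terms to the form they have in
      \<open>conv_assoc_left\<close>.\<close>
    also have "\<dots> = fam_sum Sm (P.splits (snd p)) (?f p)"
      by (rule fam_sum_cong[OF small_splits])
        (use Fun_fst[OF l p] Fun_fst[OF m] Fun_snd[OF n] in \<open>auto simp: m_assoc\<close>)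
    finally show "l (fst p) \<otimes> (m \<star> n) (snd p) = fam_sum Sm (P.splits (snd p)) (?f p)" .
  qed
  also have "\<dots> = fam_sum Sm ?S (\<lambda>(p, q). ?f p q)"
    by (rule fam_sum_Sigma[OF small_splits small f])
  also have "\<dots> = fam_sum Sm (P.splits3 x)
      (\<lambda>t. case (case t of (a, b, c) \<Rightarrow> ((a, b \<diamondop>\<^bsub>P\<^esub> c), (b, c))) of (p, q) \<Rightarrow> ?f p q)"
    by (rule fam_sum_reindex[OF small P.splits3_right, symmetric]) (use f in auto)
  also have "\<dots> = fam_sum Sm (P.splits3 x) (\<lambda>(a, b, c). l a \<otimes> m b \<otimes> n c)"
    by (simp add: case_prod_beta')
  finally show ?thesis .
qed

lemma conv_assoc: "l \<in> Fun \<Longrightarrow> m \<in> Fun \<Longrightarrow> n \<in> Fun \<Longrightarrow> (l \<star> m) \<star> n = l \<star> (m \<star> n)"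
  by (rule Fun_eqI) (simp_all add: conv_closed conv_assoc_left conv_assoc_right)

text \<open>The analogue of diagonal matrices; \<open>fun_one\<close>, \<open>fun_zero\<close>, all
  tests and all weights are of this kind.\<close>

definition diagonal :: "('g \<Rightarrow> 's) set" where
  "diagonal = {l \<in> Fun. \<forall>x \<in> carrier P. x \<notin> ids P \<longrightarrow> l x = \<zero>}"

text \<open>A factorization of \<open>x\<close> contributes only if its first factor is an identity.
  Then the second factor is \<open>x\<close> and, by uniqueness, the first is \<open>e\<close>, so a
  single term survives.\<close>

lemma conv_diagonal_left:
  assumes l: "l \<in> diagonal" and m: "m \<in> Fun" and e: "e \<in> ids P" "(e, x) \<in> defd P"
  shows "(l \<star> m) x = l e \<otimes> m x"
proof -
  have x: "x \<in> carrier P" and lF: "l \<in> Fun"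
    using e l P.defd_subset by (auto simp: diagonal_def)
  have ex: "(e, x) \<in> P.splits x"
    using e P.left_id by (auto simp: P.splits_def)
  have "l (fst p) \<otimes> m (snd p) = \<zero>" if p: "p \<in> P.splits x" "p \<noteq> (e, x)" for p
  proof (cases "fst p \<in> ids P")
    case True
    obtain y z where yz: "p = (y, z)" "(y, z) \<in> defd P" "y \<diamondop>\<^bsub>P\<^esub> z = x"
      using p by (auto simp: P.splits_def)
    then have "z = x"
      using True P.left_id by fastforce
    then have "p = (e, x)"
      using yz True e P.left_id_unique by auto
    then show ?thesis
      using p by simp
  next
    case False
    then show ?thesis
      using l p P.splits_closed[of p x] Fun_snd[OF m] by (auto simp: diagonal_def)
  qed
  moreover have "l e \<otimes> m x \<in> carrier S"
    using Fun_fst[OF lF ex] Fun_snd[OF m ex] by simp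
  ultimately show ?thesis
    unfolding conv_apply[OF x]
    using fam_sum_single[OF small_splits ex, of "\<lambda>p. l (fst p) \<otimes> m (snd p)"] by simp
qed

lemma conv_diagonal_right:
  assumes l: "l \<in> Fun" and m: "m \<in> diagonal" and e: "e \<in> ids P" "(x, e) \<in> defd P"
  shows "(l \<star> m) x = l x \<otimes> m e"
proof -
  have x: "x \<in> carrier P" and mF: "m \<in> Fun"
    using e m P.defd_subset by (auto simp: diagonal_def)
  have ex: "(x, e) \<in> P.splits x"
    using e P.right_id by (auto simp: P.splits_def)
  have "l (fst p) \<otimes> m (snd p) = \<zero>" if p: "p \<in> P.splits x" "p \<noteq> (x, e)" for p
  proof (cases "snd p \<in> ids P")
    case True
    obtain y z where yz: "p = (y, z)" "(y, z) \<in> defd P" "y \<diamondop>\<^bsub>P\<^esub> z = x"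
      using p by (auto simp: P.splits_def)
    then have "y = x"
      using True P.right_id by fastforce
    then have "p = (x, e)"
      using yz True e P.right_id_unique by auto
    then show ?thesis
      using p by simp
  next
    case False
    then show ?thesis
      using m p P.splits_closed[of p x] Fun_fst[OF l] by (auto simp: diagonal_def)
  qed
  moreover have "l x \<otimes> m e \<in> carrier S"
    using Fun_fst[OF l ex] Fun_snd[OF mF ex] by simp
  ultimately show ?thesis
    unfolding conv_apply[OF x]
    using fam_sum_single[OF small_splits ex, of "\<lambda>p. l (fst p) \<otimes> m (snd p)"] by simp
qed

text \<open>An identity is its own left identity, and at any other \<open>x\<close> both sides
  vanish because \<open>m x = \<zero>\<close>.\<close>

lemma conv_diagonal:
  assumes l: "l \<in> diagonal" and m: "m \<in> diagonal" and x: "x \<in> carrier P"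
  shows "(l \<star> m) x = l x \<otimes> m x"
proof (cases "x \<in> ids P")
  case True
  then show ?thesis
    using conv_diagonal_left[OF l _ True P.id_defd[OF True]] m by (simp add: diagonal_def)
next
  case False
  obtain e where e: "e \<in> ids P" "(e, x) \<in> defd P"
    using P.left_id_ex[OF x] by blast
  then have "e \<in> carrier P"
    using P.ids_subset by blast
  then show ?thesis
    using conv_diagonal_left[OF l _ e, of m] l m x False by (auto simp: diagonal_def PiE_iff)
qed

lemma one_diagonal: "fun_one P S \<in> diagonal"
  and zero_diagonal: "fun_zero P S \<in> diagonal"
  by (auto simp: diagonal_def fun_one_closed fun_one_apply fun_zero_closed fun_zero_apply)

lemma conv_one_left: "l \<in> Fun \<Longrightarrow> fun_one P S \<star> l = l"
proof (rule Fun_eqI)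
  fix x assume l: "l \<in> Fun" and x: "x \<in> carrier P"
  obtain e where e: "e \<in> ids P" "(e, x) \<in> defd P"
    using P.left_id_ex[OF x] by blast
  then have "e \<in> carrier P"
    using P.ids_subset by blast
  then show "(fun_one P S \<star> l) x = l x"
    using conv_diagonal_left[OF one_diagonal l e] l x e by (auto simp: fun_one_apply PiE_iff)
qed (simp_all add: conv_closed fun_one_closed)

lemma conv_one_right: "l \<in> Fun \<Longrightarrow> l \<star> fun_one P S = l"
proof (rule Fun_eqI)
  fix x assume l: "l \<in> Fun" and x: "x \<in> carrier P"
  obtain e where e: "e \<in> ids P" "(x, e) \<in> defd P"
    using P.right_id_ex[OF x] by blast
  then have "e \<in> carrier P"
    using P.ids_subset by blast
  then show "(l \<star> fun_one P S) x = l x"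
    using conv_diagonal_right[OF l one_diagonal e] l x e by (auto simp: fun_one_apply PiE_iff)
qed (simp_all add: conv_closed fun_one_closed)

section \<open>Annihilation, distributivity and the idempotent semiring of functions\<close>

lemma conv_zero_left: "l \<in> Fun \<Longrightarrow> fun_zero P S \<star> l = fun_zero P S"
proof (rule Fun_eqI)
  fix x assume l: "l \<in> Fun" and x: "x \<in> carrier P"
  show "(fun_zero P S \<star> l) x = fun_zero P S x"
    unfolding conv_apply[OF x] fun_zero_apply[OF x]
    by (rule fam_sum_zero[OF small_splits])
      (use Fun_snd[OF l] P.splits_closed in \<open>auto simp: fun_zero_apply\<close>)
qed (simp_all add: conv_closed fun_zero_closed)

lemma conv_zero_right: "l \<in> Fun \<Longrightarrow> l \<star> fun_zero P S = fun_zero P S"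
proof (rule Fun_eqI)
  fix x assume l: "l \<in> Fun" and x: "x \<in> carrier P"
  show "(l \<star> fun_zero P S) x = fun_zero P S x"
    unfolding conv_apply[OF x] fun_zero_apply[OF x]
    by (rule fam_sum_zero[OF small_splits])
      (use Fun_fst[OF l] P.splits_closed in \<open>auto simp: fun_zero_apply\<close>)
qed (simp_all add: conv_closed fun_zero_closed)

lemma conv_add_left:
  assumes l: "l \<in> Fun" and m: "m \<in> Fun" and n: "n \<in> Fun"
  shows "(l \<boxplus> m) \<star> n = (l \<star> n) \<boxplus> (m \<star> n)"
proof (rule Fun_eqI)
  fix x assume x: "x \<in> carrier P"
  have "((l \<boxplus> m) \<star> n) x =
      fam_sum Sm (P.splits x) (\<lambda>p. l (fst p) \<otimes> n (snd p) \<oplus> m (fst p) \<otimes> n (snd p))"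
    unfolding conv_apply[OF x]
    by (rule fam_sum_cong[OF small_splits])
      (use Fun_fst[OF l] Fun_fst[OF m] Fun_snd[OF n] P.splits_closed in
        \<open>auto simp: add_apply l_distr\<close>)
  also have "\<dots> = (l \<star> n) x \<oplus> (m \<star> n) x"
    unfolding conv_apply[OF x]
    by (rule fam_sum_add[OF small_splits])
      (use Fun_fst[OF l] Fun_fst[OF m] Fun_snd[OF n] in auto)
  finally show "((l \<boxplus> m) \<star> n) x = ((l \<star> n) \<boxplus> (m \<star> n)) x"
    by (simp add: add_apply x)
qed (simp_all add: conv_closed add_closed assms)

lemma conv_add_right:
  assumes l: "l \<in> Fun" and m: "m \<in> Fun" and n: "n \<in> Fun"
  shows "n \<star> (l \<boxplus> m) = (n \<star> l) \<boxplus> (n \<star> m)"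
proof (rule Fun_eqI)
  fix x assume x: "x \<in> carrier P"
  have "(n \<star> (l \<boxplus> m)) x =
      fam_sum Sm (P.splits x) (\<lambda>p. n (fst p) \<otimes> l (snd p) \<oplus> n (fst p) \<otimes> m (snd p))"
    unfolding conv_apply[OF x]
    by (rule fam_sum_cong[OF small_splits])
      (use Fun_snd[OF l] Fun_snd[OF m] Fun_fst[OF n] P.splits_closed in
        \<open>auto simp: add_apply r_distr\<close>)
  also have "\<dots> = (n \<star> l) x \<oplus> (n \<star> m) x"
    unfolding conv_apply[OF x]
    by (rule fam_sum_add[OF small_splits])
      (use Fun_snd[OF l] Fun_snd[OF m] Fun_fst[OF n] in auto)
  finally show "(n \<star> (l \<boxplus> m)) x = ((n \<star> l) \<boxplus> (n \<star> m)) x"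
    by (simp add: add_apply x)
qed (simp_all add: conv_closed add_closed assms)

abbreviation K :: "('g \<Rightarrow> 's) kawt" where
  "K \<equiv> fun_kawt P S Sm"

lemma K_simps [simp]:
  "carrier K = Fun" "mult K = fun_mult P S Sm" "one K = fun_one P S" "zero K = fun_zero P S"
  "add K = fun_add P S" "star K = fun_star P S Sm" "tests K = fun_tests P S"
  "weights K = fun_weights P S" "test_compl K = fun_compl P S"
  by (simp_all add: fun_kawt_def)

lemma padd_laws:
  assumes "l \<in> Fun" "m \<in> Fun" "n \<in> Fun"
  shows "l \<boxplus> m \<boxplus> n = l \<boxplus> (m \<boxplus> n)" "l \<boxplus> m = m \<boxplus> l" "fun_zero P S \<boxplus> l = l" "l \<boxplus> l = l"
  by (rule Fun_eqI; simp add: assms add_closed fun_zero_closed add_apply fun_zero_apply Fun_apply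
      a_ac add_idem)+

lemma idem_semiring_K: "idem_semiring K"
  by (intro idem_semiring.intro semiring.intro abelian_monoidI monoidI semiring_axioms.intro
      idem_semiring_axioms.intro, unfold K_simps)
    (fact add_closed conv_closed fun_zero_closed fun_one_closed conv_assoc
      conv_one_left conv_one_right conv_zero_left conv_zero_right conv_add_left conv_add_right |
      rule padd_laws, assumption+)+

lemma pow_K: "l [^]\<^bsub>K\<^esub> n = fun_pow P S Sm l n"
  by (induction n) simp_all

lemma pow_closed: "l \<in> Fun \<Longrightarrow> fun_pow P S Sm l n \<in> Fun"
  by (induction n) (simp_all add: fun_one_closed conv_closed)

section \<open>Countable pointwise sums and the star\<close>

definition psum :: "(nat \<Rightarrow> 'g \<Rightarrow> 's) \<Rightarrow> 'g \<Rightarrow> 's" where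
  "psum F = (\<lambda>x \<in> carrier P. fam_sum Sm UNIV (\<lambda>n. F n x))"

lemma psum_apply: "x \<in> carrier P \<Longrightarrow> psum F x = fam_sum Sm UNIV (\<lambda>n. F n x)"
  by (simp add: psum_def)

lemma psum_closed:
  assumes "\<And>n. F n \<in> Fun"
  shows "psum F \<in> Fun"
  unfolding psum_def
  by (rule restrict_PiE[THEN iffD2]) (use Fun_apply[OF assms] in \<open>auto intro!: fam_sum_closed small_nat\<close>)

lemma star_eq_psum: "fun_star P S Sm l = psum (fun_pow P S Sm l)"
  by (simp add: fun_star_def psum_def)

text \<open>After distributing \<open>l (fst p)\<close> over the countable sum, the sum over
  factorizations and the sum over \<open>nat\<close> are interchanged.\<close>

lemma conv_psum_right:
  assumes l: "l \<in> Fun" and F: "\<And>n. F n \<in> Fun"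
  shows "l \<star> psum F = psum (\<lambda>n. l \<star> F n)"
proof (rule Fun_eqI)
  fix x assume x: "x \<in> carrier P"
  have "(l \<star> psum F) x =
      fam_sum Sm (P.splits x) (\<lambda>p. fam_sum Sm UNIV (\<lambda>n. l (fst p) \<otimes> F n (snd p)))"
    unfolding conv_apply[OF x]
  proof (rule fam_sum_cong[OF small_splits])
    show "(\<lambda>p. l (fst p) \<otimes> psum F (snd p)) \<in> P.splits x \<rightarrow> carrier S"
      using Fun_fst[OF l] Fun_snd[OF psum_closed[OF F]] by auto
  next
    fix p assume p: "p \<in> P.splits x"
    show "l (fst p) \<otimes> psum F (snd p) = fam_sum Sm UNIV (\<lambda>n. l (fst p) \<otimes> F n (snd p))"
      unfolding psum_apply[OF P.splits_closed[OF p, THEN conjunct2]]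
      by (rule fam_sum_distrib_left[OF small_nat Fun_fst[OF l p]]) (use Fun_snd[OF F p] in auto)
  qed
  also have "\<dots> = fam_sum Sm UNIV (\<lambda>n. (l \<star> F n) x)"
    unfolding conv_apply[OF x]
    by (rule fam_sum_swap[OF small_splits small_nat]) (use Fun_fst[OF l] Fun_snd[OF F] in auto)
  finally show "(l \<star> psum F) x = psum (\<lambda>n. l \<star> F n) x"
    by (simp add: psum_apply x)
qed (simp_all add: conv_closed psum_closed assms)

lemma conv_psum_left:
  assumes l: "l \<in> Fun" and F: "\<And>n. F n \<in> Fun"
  shows "psum F \<star> l = psum (\<lambda>n. F n \<star> l)"
proof (rule Fun_eqI)
  fix x assume x: "x \<in> carrier P"
  have "(psum F \<star> l) x =
      fam_sum Sm (P.splits x) (\<lambda>p. fam_sum Sm UNIV (\<lambda>n. F n (fst p) \<otimes> l (snd p)))"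
    unfolding conv_apply[OF x]
  proof (rule fam_sum_cong[OF small_splits])
    show "(\<lambda>p. psum F (fst p) \<otimes> l (snd p)) \<in> P.splits x \<rightarrow> carrier S"
      using Fun_snd[OF l] Fun_fst[OF psum_closed[OF F]] by auto
  next
    fix p assume p: "p \<in> P.splits x"
    show "psum F (fst p) \<otimes> l (snd p) = fam_sum Sm UNIV (\<lambda>n. F n (fst p) \<otimes> l (snd p))"
      unfolding psum_apply[OF P.splits_closed[OF p, THEN conjunct1]]
      by (rule fam_sum_distrib_right[OF small_nat Fun_snd[OF l p]]) (use Fun_fst[OF F p] in auto)
  qed
  also have "\<dots> = fam_sum Sm UNIV (\<lambda>n. (F n \<star> l) x)"
    unfolding conv_apply[OF x]
    by (rule fam_sum_swap[OF small_splits small_nat]) (use Fun_snd[OF l] Fun_fst[OF F] in auto)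
  finally show "(psum F \<star> l) x = psum (\<lambda>n. F n \<star> l) x"
    by (simp add: psum_apply x)
qed (simp_all add: conv_closed psum_closed assms)

text \<open>The order of \<open>K\<close> is pointwise, so both halves reduce to the corresponding
  facts about countable sums in \<open>S\<close>.\<close>

lemma psum_lub:
  assumes F: "\<And>n. F n \<in> Fun"
  shows "least (nat_order K) (psum F) (Upper (nat_order K) {F n | n. True})"
proof (rule least_UpperI)
  fix l assume "l \<in> {F n | n. True}"
  then obtain n where l: "l = F n"
    by blast
  have "F n \<boxplus> psum F = psum F"
    by (rule Fun_eqI)
      (use countable_sum_upper[of "\<lambda>n. F n _"] Fun_apply[OF F] in
        \<open>simp_all add: add_closed psum_closed F add_apply psum_apply\<close>)
  then show "l \<sqsubseteq>\<^bsub>nat_order K\<^esub> psum F"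
    by (simp add: l)
next
  fix z assume "z \<in> Upper (nat_order K) {F n | n. True}"
  then have z: "z \<in> Fun" and F_le: "F n \<boxplus> z = z" for n
    using F unfolding Upper_def by (simp, simp, blast)
  have "psum F \<boxplus> z = z"
  proof (rule Fun_eqI)
    fix x assume x: "x \<in> carrier P"
    have "F n x \<oplus> z x = z x" for n
      using fun_cong[OF F_le[of n], of x] x by (simp add: add_apply)
    then show "(psum F \<boxplus> z) x = z x"
      using countable_sum_least[of "\<lambda>n. F n x" "z x"] Fun_apply[OF F x] Fun_apply[OF z x] x
      by (simp add: add_apply psum_apply)
  qed (simp_all add: add_closed psum_closed F z)
  then show "psum F \<sqsubseteq>\<^bsub>nat_order K\<^esub> z"
    by simp
next
  show "{F n | n. True} \<subseteq> carrier (nat_order K)" "psum F \<in> carrier (nat_order K)"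
    using F psum_closed[OF F] by auto
qed

lemma star_continuous_K: "star_continuous K"
  unfolding star_continuous_def
proof (intro ballI)
  fix l m n assume "l \<in> carrier K" "m \<in> carrier K" "n \<in> carrier K"
  then have F: "l \<in> Fun" "m \<in> Fun" "n \<in> Fun"
    by simp_all
  note closed = F pow_closed conv_closed
  \<comment> \<open>Convolution with \<open>l\<close> from the left and with \<open>n\<close> from
    the right both pass through the countable sum that defines the star.\<close>
  have eq: "l \<star> fun_star P S Sm m \<star> n = psum (\<lambda>k. l \<star> fun_pow P S Sm m k \<star> n)"
    by (simp add: star_eq_psum conv_psum_right conv_psum_left closed)
  show "least (nat_order K) (l \<otimes>\<^bsub>K\<^esub> star K m \<otimes>\<^bsub>K\<^esub> n)
      (Upper (nat_order K) {l \<otimes>\<^bsub>K\<^esub> (m [^]\<^bsub>K\<^esub> k) \<otimes>\<^bsub>K\<^esub> n | k :: nat. True})"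
    unfolding pow_K K_simps eq by (rule psum_lub) (simp add: closed)
qed

lemma kleene_algebra_K: "kleene_algebra K"
  by (rule kleene_algebra_if_star_continuous[OF idem_semiring_K _ star_continuous_K])
    (simp add: star_eq_psum psum_closed pow_closed)

section \<open>The Boolean algebra of tests\<close>

lemma tests_diagonal: "l \<in> fun_tests P S \<Longrightarrow> l \<in> diagonal"
  and tests_cases: "l \<in> fun_tests P S \<Longrightarrow> x \<in> carrier P \<Longrightarrow> l x = \<one> \<or> l x = \<zero>"
  by (auto simp: fun_tests_def diagonal_def)

lemma tests_Fun: "l \<in> fun_tests P S \<Longrightarrow> l \<in> Fun"
  by (simp add: fun_tests_def)

lemma testsI:
  "l \<in> Fun \<Longrightarrow> (\<And>x. x \<in> carrier P \<Longrightarrow> l x = \<one> \<or> l x = \<zero>) \<Longrightarrow>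
    (\<And>x. x \<in> carrier P \<Longrightarrow> x \<notin> ids P \<Longrightarrow> l x = \<zero>) \<Longrightarrow> l \<in> fun_tests P S"
  by (auto simp: fun_tests_def)

lemma tests_off_ids: "l \<in> fun_tests P S \<Longrightarrow> x \<in> carrier P \<Longrightarrow> x \<notin> ids P \<Longrightarrow> l x = \<zero>"
  by (simp add: fun_tests_def)

lemma tests_eqI:
  "l \<in> fun_tests P S \<Longrightarrow> m \<in> fun_tests P S \<Longrightarrow> (\<And>x. x \<in> carrier P \<Longrightarrow> l x = m x) \<Longrightarrow> l = m"
  by (rule Fun_eqI[OF tests_Fun tests_Fun])

lemma conv_tests_apply:
  "l \<in> fun_tests P S \<Longrightarrow> m \<in> fun_tests P S \<Longrightarrow> x \<in> carrier P \<Longrightarrow> (l \<star> m) x = l x \<otimes> m x"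
  by (intro conv_diagonal tests_diagonal)

lemma one_tests: "fun_one P S \<in> fun_tests P S"
  and zero_tests: "fun_zero P S \<in> fun_tests P S"
  by (intro testsI; simp add: fun_one_closed fun_one_apply fun_zero_closed fun_zero_apply)+

lemma compl_apply:
  "x \<in> carrier P \<Longrightarrow> fun_compl P S l x = (if x \<in> ids P \<and> l x \<noteq> \<one> then \<one> else \<zero>)"
  by (simp add: fun_compl_def)

lemma compl_tests: "fun_compl P S l \<in> fun_tests P S"
  by (intro testsI) (auto simp: fun_compl_def)

lemma conv_tests: "l \<in> fun_tests P S \<Longrightarrow> m \<in> fun_tests P S \<Longrightarrow> l \<star> m \<in> fun_tests P S"
proof (rule testsI)
  fix x assume "l \<in> fun_tests P S" "m \<in> fun_tests P S" "x \<in> carrier P"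
  then show "(l \<star> m) x = \<one> \<or> (l \<star> m) x = \<zero>"
    using tests_cases[of l x] tests_cases[of m x] by (auto simp: conv_tests_apply)
qed (simp_all add: conv_closed tests_Fun conv_tests_apply tests_off_ids)

lemma add_tests: "l \<in> fun_tests P S \<Longrightarrow> m \<in> fun_tests P S \<Longrightarrow> l \<boxplus> m \<in> fun_tests P S"
proof (rule testsI)
  fix x assume "l \<in> fun_tests P S" "m \<in> fun_tests P S" "x \<in> carrier P"
  then show "(l \<boxplus> m) x = \<one> \<or> (l \<boxplus> m) x = \<zero>"
    using tests_cases[of l x] tests_cases[of m x] by (auto simp: add_apply add_idem)
qed (simp_all add: add_closed tests_Fun add_apply tests_off_ids)

text \<open>Lattice laws that a semiring need not satisfy but that hold for the values
  \<open>\<zero>\<close> and \<open>\<one>\<close>, thanks to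
  \<open>\<one> \<oplus> \<one> = \<one>\<close>. The case \<open>\<one> = \<zero>\<close> is
  covered too.\<close>

lemma bits:
  assumes "a = \<one> \<or> a = \<zero>" "b = \<one> \<or> b = \<zero>"
  shows "a \<otimes> b = b \<otimes> a" "a \<otimes> (a \<oplus> b) = a" "a \<oplus> a \<otimes> b = a"
    and "c = \<one> \<or> c = \<zero> \<Longrightarrow> a \<oplus> b \<otimes> c = (a \<oplus> b) \<otimes> (a \<oplus> c)"
  using assms by (auto simp: add_idem)

lemma boolean_algebra_tests:
  "boolean_algebra_on (fun_tests P S) (fun_mult P S Sm) (fun_add P S) (fun_compl P S)
    (fun_one P S) (fun_zero P S)"
proof
  note closed = one_tests zero_tests compl_tests conv_tests add_tests
  note apply_simps = conv_tests_apply add_apply compl_apply fun_one_apply fun_zero_apply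
  fix l m n
  assume l: "l \<in> fun_tests P S"
  show "l \<star> fun_one P S = l"
    using l by (simp add: conv_one_right tests_Fun)
  show "l \<boxplus> fun_zero P S = l"
    by (rule tests_eqI) (simp_all add: closed apply_simps l Fun_apply tests_Fun)
  show "l \<star> fun_compl P S l = fun_zero P S"
  proof (rule tests_eqI)
    fix x assume x: "x \<in> carrier P"
    show "(l \<star> fun_compl P S l) x = fun_zero P S x"
      using tests_cases[OF l x] x by (auto simp: closed apply_simps l)
  qed (simp_all add: closed l)
  \<comment> \<open>The top test vanishes off the identities, so \<open>tests_off_ids\<close> is
    what gives equality there.\<close>
  show "l \<boxplus> fun_compl P S l = fun_one P S"
  proof (rule tests_eqI)
    fix x assume x: "x \<in> carrier P"
    show "(l \<boxplus> fun_compl P S l) x = fun_one P S x"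
      using tests_cases[OF l x] tests_off_ids[OF l x] x by (auto simp: closed apply_simps)
  qed (simp_all add: closed l)
  assume m: "m \<in> fun_tests P S"
  note lm_bits = bits(1-3)[OF tests_cases[OF l] tests_cases[OF m]]
  show "l \<star> m = m \<star> l"
    by (rule tests_eqI) (simp_all add: closed apply_simps l m lm_bits(1))
  show "l \<boxplus> m = m \<boxplus> l"
    by (rule tests_eqI) (simp_all add: closed apply_simps l m a_comm Fun_apply tests_Fun)
  show "l \<star> (l \<boxplus> m) = l"
    by (rule tests_eqI) (simp_all add: closed apply_simps l m lm_bits(2))
  show "l \<boxplus> (l \<star> m) = l"
    by (rule tests_eqI) (simp_all add: closed apply_simps l m lm_bits(3))
  assume n: "n \<in> fun_tests P S"
  \<comment> \<open>Associativity of convolution and its distributivity over addition are inherited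
    from the semiring of all functions; the other distributive law is checked on values.\<close>
  show "l \<star> m \<star> n = l \<star> (m \<star> n)"
    using l m n by (simp add: conv_assoc tests_Fun)
  show "l \<boxplus> m \<boxplus> n = l \<boxplus> (m \<boxplus> n)"
    by (rule tests_eqI) (simp_all add: closed apply_simps l m n a_assoc Fun_apply tests_Fun)
  show "l \<star> (m \<boxplus> n) = (l \<star> m) \<boxplus> (l \<star> n)"
    using l m n by (simp add: conv_add_right tests_Fun)
  show "l \<boxplus> (m \<star> n) = (l \<boxplus> m) \<star> (l \<boxplus> n)"
    by (rule tests_eqI)
      (simp_all add: closed apply_simps l m n
        bits(4)[OF tests_cases[OF l] tests_cases[OF m] tests_cases[OF n]])
qed (auto intro: one_tests zero_tests compl_tests conv_tests add_tests)

section \<open>The semiring of weights and its isomorphism with \<open>S\<close>\<close>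

lemma weights_diagonal: "l \<in> fun_weights P S \<Longrightarrow> l \<in> diagonal"
  and weights_Fun: "l \<in> fun_weights P S \<Longrightarrow> l \<in> Fun"
  unfolding fun_weights_def diagonal_def by blast+

lemma weights_const: "l \<in> fun_weights P S \<Longrightarrow> y \<in> ids P \<Longrightarrow> z \<in> ids P \<Longrightarrow> l y = l z"
  unfolding fun_weights_def by blast

lemma weightsI:
  "l \<in> diagonal \<Longrightarrow> (\<And>y z. y \<in> ids P \<Longrightarrow> z \<in> ids P \<Longrightarrow> l y = l z) \<Longrightarrow> l \<in> fun_weights P S"
  unfolding fun_weights_def diagonal_def by blast

lemma ids_closed: "e \<in> ids P \<Longrightarrow> e \<in> carrier P"
  using P.ids_subset by blast

lemma diagonal_closed:
  assumes "l \<in> diagonal" "m \<in> diagonal"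
  shows "l \<star> m \<in> diagonal" "l \<boxplus> m \<in> diagonal"
  using assms conv_diagonal[OF assms]
  by (simp_all add: diagonal_def conv_closed add_closed add_apply)

lemma conv_weights:
  assumes "l \<in> fun_weights P S" "m \<in> fun_weights P S"
  shows "l \<star> m \<in> fun_weights P S"
proof (rule weightsI)
  fix y z assume "y \<in> ids P" "z \<in> ids P"
  then show "(l \<star> m) y = (l \<star> m) z"
    using assms weights_const[of l y z] weights_const[of m y z]
    by (simp add: conv_diagonal weights_diagonal ids_closed)
qed (simp add: assms diagonal_closed weights_diagonal)

lemma add_weights:
  assumes "l \<in> fun_weights P S" "m \<in> fun_weights P S"
  shows "l \<boxplus> m \<in> fun_weights P S"
proof (rule weightsI)
  fix y z assume "y \<in> ids P" "z \<in> ids P"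
  then show "(l \<boxplus> m) y = (l \<boxplus> m) z"
    using assms weights_const[of l y z] weights_const[of m y z]
    by (simp add: add_apply ids_closed)
qed (simp add: assms diagonal_closed weights_diagonal)

lemma one_weights: "fun_one P S \<in> fun_weights P S"
  and zero_weights: "fun_zero P S \<in> fun_weights P S"
  by (intro weightsI; simp add: one_diagonal zero_diagonal fun_one_apply fun_zero_apply ids_closed)+

lemma semiring_weights: "semiring (weight_semiring K)"
proof -
  interpret K: idem_semiring K
    by (rule idem_semiring_K)
  show ?thesis
    unfolding weight_semiring_def
    by (rule K.semiring_subset)
      (auto simp: one_weights zero_weights add_weights conv_weights dest: weights_Fun)
qed

lemma kleene_algebra_weights_tests_K: "kleene_algebra_weights_tests K"
  by (intro kleene_algebra_weights_tests.intro kleene_algebra_K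
      kleene_algebra_weights_tests_axioms.intro semiring_weights)
    (auto simp: boolean_algebra_tests dest: tests_Fun weights_Fun)

text \<open>A weight is the analogue of a scalar matrix, so its value at any one identity determines
  it. Evaluation there is multiplicative because convolution of diagonal functions is
  pointwise.\<close>

lemma weights_iso:
  assumes e: "e \<in> ids P"
  shows "(\<lambda>l. l e) \<in> ring_iso (weight_semiring K) S"
proof -
  have carrier_W: "carrier (weight_semiring K) = fun_weights P S"
    by (simp add: weight_semiring_def)
  have hom: "(\<lambda>l. l e) \<in> ring_hom (weight_semiring K) S"
    by (rule ring_hom_memI)
      (use e in \<open>simp_all add: weight_semiring_def conv_diagonal weights_diagonal add_apply
        fun_one_apply ids_closed Fun_apply weights_Fun\<close>)
  have inj: "inj_on (\<lambda>l. l e) (fun_weights P S)"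
  proof (rule inj_onI, rule Fun_eqI)
    fix l m x
    assume lm: "l \<in> fun_weights P S" "m \<in> fun_weights P S" "l e = m e" and x: "x \<in> carrier P"
    show "l x = m x"
    proof (cases "x \<in> ids P")
      case True
      then show ?thesis
        using lm weights_const[of l x e] weights_const[of m x e] e by simp
    next
      case False
      then show ?thesis
        using lm(1,2)[THEN weights_diagonal] x by (simp add: diagonal_def)
    qed
  qed (simp_all add: weights_Fun)
  have "\<exists>l \<in> fun_weights P S. l e = s" if s: "s \<in> carrier S" for s
  proof
    \<comment> \<open>The scalar function with value \<open>s\<close> is the preimage of
      \<open>s\<close>.\<close>
    show "(\<lambda>x \<in> carrier P. if x \<in> ids P then s else \<zero>) \<in> fun_weights P S"
      using s by (auto simp: fun_weights_def ids_closed)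
  qed (use e in \<open>simp add: ids_closed\<close>)
  then have "bij_betw (\<lambda>l. l e) (fun_weights P S) (carrier S)"
    using inj e by (auto simp: bij_betw_def ids_closed Fun_apply weights_Fun image_iff)
  then show ?thesis
    using hom by (simp add: ring_iso_def carrier_W)
qed

end

theorem theorem1:
  fixes P :: "('g, 'p) psemigroup_scheme"
    and S :: "('s, 'm) ring_scheme"
    and Sm :: "'i set \<Rightarrow> ('i \<Rightarrow> 's) \<Rightarrow> 's"
  assumes "partial_semigroup P"
    and "complete_semiring S Sm"
    and "infinite (UNIV :: 'i set)" and "carrier P \<lesssim> (UNIV :: 'i set)"
    and "idem_semiring S"
    and "\<And>x. x \<in> carrier S \<Longrightarrow> fam_sum Sm (UNIV :: nat set) (\<lambda>n. x) = x"
  shows "kleene_algebra_weights_tests (fun_kawt P S Sm) \<and>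
    star_continuous (fun_kawt P S Sm) \<and>
    (\<exists>h \<in> ring_iso (weight_semiring (fun_kawt P S Sm)) S.
      h \<zero>\<^bsub>weight_semiring (fun_kawt P S Sm)\<^esub> = \<zero>\<^bsub>S\<^esub>)"
proof -
  have S: "infinitary_semiring S Sm"
    using assms(2,3) by (simp add: infinitary_semiring_def infinitary_semiring_axioms_def)
  have "countably_idem_semiring S Sm"
    using S assms(5,6) by (simp add: countably_idem_semiring_def countably_idem_semiring_axioms_def)
  moreover have "function_algebra_axioms TYPE('i) P"
    using assms(4) by (simp add: function_algebra_axioms_def infinitary_semiring.small_def[OF S])
  ultimately interpret function_algebra P S Sm
    using assms(1) by (simp add: function_algebra_def)
  obtain e where e: "e \<in> ids P"
    using P.ids_nonempty by blast
  \<comment> \<open>The definition of \<open>ring_iso\<close> does not mention zero, so its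
    preservation is checked directly by evaluating the zero function at \<open>e\<close>.\<close>
  have zero: "\<zero>\<^bsub>weight_semiring K\<^esub> e = \<zero>\<^bsub>S\<^esub>"
    using e by (simp add: weight_semiring_def fun_zero_apply ids_closed)
  show ?thesis
    by (intro conjI kleene_algebra_weights_tests_K star_continuous_K bexI[OF _ weights_iso[OF e]])
      (rule zero)
qed

end
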